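(* Let $G=(V,E)$ be a tree tensor network over an infinite field $\Bbbk$, with bond dimensions $\mathbf r$. If $\mathbf r$ is admissible, then $\mathrm{TN}^\circ(G,\mathbf r)$ is a nonempty Zariski open and dense subset of $\mathrm{TN}(G,\mathbf r)$. If $\mathbf r$ is not admissible, then $\mathrm{TN}^\circ(G,\mathbf r)=\emptyset$.
   Context: Tree tensor network: $G=(V,E)$ is a tree with vertices $V=\{1,\dots,d\}$ and directed edges $E$; each vertex $i$ carries a finite-dimensional vector space $\mathbb V_i$ over $\Bbbk$; each edge $(i,j)$ carries a bond dimension $r_{ij}\ge1$ and bond space $\mathbb E_{ij}$ of dimension $r_{ij}$ with dual $\mathbb E_{ji}^*$. Local tensors are $T_i\in\mathbb I_i^*\otimes\mathbb V_i\otimes\mathbb O_i$ with $\mathbb I_i^*=\bigotimes_{j\in\mathrm{in}(i)}\mathbb E_{ji}^*$, $\mathbb O_i=\bigotimes_{j\in\mathrm{out}(i)}\mathbb E_{ij}$, and $g$ is the linear contraction map pairing $\mathbb E_{ji}^*$ with $\mathbb E_{ij}$ along every edge, with values in $\mathbb V_1\otimes\cdots\otimes\mathbb V_d$. $\mathrm{TN}(G,\mathbf r)=\{g(T_1\otimes\cdots\otimes T_d)\}$ over all choices of local tensors with bond dimensions $\mathbf r$ (an irreducible affine variety in $\mathbb V_1\otimes\cdots\otimes\mathbb V_d$), and $\mathrm{TN}^\circ(G,\mathbf r)=\mathrm{TN}(G,\mathbf r)\setminus\bigcup_{\mathbf s\le\mathbf r,\ \mathbf s\neq\mathbf r}\mathrm{TN}(G,\mathbf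 s)$ (inequality componentwise), i.e. the tensors for which $\mathbf r$ is minimal. The bond dimensions $\mathbf r$ are admissible if for every vertex $i$ and every neighbour $j\in\mathrm{nb}(i)$: $r_{ij}\le\dim\mathbb V_i\prod_{k\in\mathrm{nb}(i)\setminus\{j\}}r_{ik}$. *)

theory Defs
  imports Main "HOL-Library.FuncSet"
begin

text \<open>Tree tensor networks in coordinates.  Vertices are 0,...,d-1; vertex i carries
  the space k^(n i); directed edges are pairs (i,j); bond dimension of edge e is r e.
  A multi-index of the ambient tensor space is an element of idx d n.\<close>

type_synonym edge = "nat \<times> nat"

definition tree_graph :: "nat \<Rightarrow> edge set \<Rightarrow> bool" where
  "tree_graph d E \<longleftrightarrow> d \<ge> 1 \<and> E \<subseteq> {0..<d} \<times> {0..<d} \<and> (\<forall>(i,j)\<in>E. i \<noteq> j)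
     \<and> card E = d - 1 \<and> (\<forall>i<d. \<forall>j<d. (i, j) \<in> (E \<union> E\<inverse>)\<^sup>*)"

definition nb :: "edge set \<Rightarrow> nat \<Rightarrow> nat set" where
  "nb E i = {j. (i, j) \<in> E \<or> (j, i) \<in> E}"

definition incident :: "edge set \<Rightarrow> nat \<Rightarrow> edge set" where
  "incident E i = {e \<in> E. fst e = i \<or> snd e = i}"

text \<open>bond dimension r_ij between neighbours i and j, regardless of edge orientation\<close>
definition bond :: "edge set \<Rightarrow> (edge \<Rightarrow> nat) \<Rightarrow> nat \<Rightarrow> nat \<Rightarrow> nat" where
  "bond E r i j = (if (i, j) \<in> E then r (i, j) else r (j, i))"

definition admissible :: "nat \<Rightarrow> (nat \<Rightarrow> nat) \<Rightarrow> edge set \<Rightarrow> (edge \<Rightarrow> nat) \<Rightarrow> bool" where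
  "admissible d n E r \<longleftrightarrow>
     (\<forall>i<d. \<forall>j\<in>nb E i. bond E r i j \<le> n i * (\<Prod>k\<in>nb E i - {j}. bond E r i k))"

definition idx :: "nat \<Rightarrow> (nat \<Rightarrow> nat) \<Rightarrow> (nat \<Rightarrow> nat) set" where
  "idx d n = PiE {0..<d} (\<lambda>i. {0..<n i})"

definition bond_assign :: "edge set \<Rightarrow> (edge \<Rightarrow> nat) \<Rightarrow> (edge \<Rightarrow> nat) set" where
  "bond_assign E r = PiE E (\<lambda>e. {0..<r e})"

text \<open>Contraction g(T_1 \<otimes> ... \<otimes> T_d).  The local tensor at vertex i is given by its
  coordinates T i \<beta> x, where \<beta> assigns bond indices to the edges incident to i and x is
  the physical index; the result is a tensor (zero outside the index set idx d n).\<close>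
definition contract :: "nat \<Rightarrow> (nat \<Rightarrow> nat) \<Rightarrow> edge set \<Rightarrow> (edge \<Rightarrow> nat)
     \<Rightarrow> (nat \<Rightarrow> (edge \<Rightarrow> nat) \<Rightarrow> nat \<Rightarrow> 'k::comm_semiring_1) \<Rightarrow> ((nat \<Rightarrow> nat) \<Rightarrow> 'k)" where
  "contract d n E r T = (\<lambda>x. if x \<in> idx d n then
      (\<Sum>\<beta>\<in>bond_assign E r. \<Prod>i<d. T i (restrict \<beta> (incident E i)) (x i)) else 0)"

definition TN :: "nat \<Rightarrow> (nat \<Rightarrow> nat) \<Rightarrow> edge set \<Rightarrow> (edge \<Rightarrow> nat) \<Rightarrow> ((nat \<Rightarrow> nat) \<Rightarrow> 'k::comm_semiring_1) set" where
  "TN d n E r = range (contract d n E r)"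

definition TNo :: "nat \<Rightarrow> (nat \<Rightarrow> nat) \<Rightarrow> edge set \<Rightarrow> (edge \<Rightarrow> nat) \<Rightarrow> ((nat \<Rightarrow> nat) \<Rightarrow> 'k::comm_semiring_1) set" where
  "TNo d n E r = TN d n E r -
     (\<Union>s\<in>{s. (\<forall>e\<in>E. 1 \<le> s e \<and> s e \<le> r e) \<and> (\<exists>e\<in>E. s e \<noteq> r e)}. TN d n E s)"

text \<open>Zariski topology on the affine space of functions v with v c = 0 for c outside the
  finite coordinate set C.  Polynomial functions in the coordinates v c, c \<in> C.\<close>

inductive_set polyfun :: "'c set \<Rightarrow> (('c \<Rightarrow> 'k::comm_ring_1) \<Rightarrow> 'k) set" for C where
  const: "(\<lambda>v. a) \<in> polyfun C"
| coord: "c \<in> C \<Longrightarrow> (\<lambda>v. v c) \<in> polyfun C"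
| add: "p \<in> polyfun C \<Longrightarrow> q \<in> polyfun C \<Longrightarrow> (\<lambda>v. p v + q v) \<in> polyfun C"
| mult: "p \<in> polyfun C \<Longrightarrow> q \<in> polyfun C \<Longrightarrow> (\<lambda>v. p v * q v) \<in> polyfun C"

definition tensor_space :: "'c set \<Rightarrow> ('c \<Rightarrow> 'k::zero) set" where
  "tensor_space C = {v. \<forall>c. c \<notin> C \<longrightarrow> v c = 0}"

definition zero_set :: "'c set \<Rightarrow> (('c \<Rightarrow> 'k::comm_ring_1) \<Rightarrow> 'k) set \<Rightarrow> ('c \<Rightarrow> 'k) set" where
  "zero_set C P = {v \<in> tensor_space C. \<forall>p\<in>P. p v = 0}"

text \<open>U is Zariski open relative to S (subspace topology).\<close>
definition zariski_openin :: "'c set \<Rightarrow> ('c \<Rightarrow> 'k::comm_ring_1) set \<Rightarrow> ('c \<Rightarrow> 'k) set \<Rightarrow> bool" where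
  "zariski_openin C S U \<longleftrightarrow> U \<subseteq> S \<and> (\<exists>P \<subseteq> polyfun C. U = S - zero_set C P)"

text \<open>S is contained in the Zariski closure of U (the common zero set of all
  polynomials vanishing on U).\<close>
definition zariski_dense_in :: "'c set \<Rightarrow> ('c \<Rightarrow> 'k::comm_ring_1) set \<Rightarrow> ('c \<Rightarrow> 'k) set \<Rightarrow> bool" where
  "zariski_dense_in C S U \<longleftrightarrow> U \<subseteq> S \<and>
     (\<forall>p\<in>polyfun C. (\<forall>v\<in>U. p v = 0) \<longrightarrow> (\<forall>v\<in>S. p v = 0))"

end

theory Submission
  imports Defs "Jordan_Normal_Form.Determinant"
begin

text \<open>Cutting the tree at an edge \<open>e\<close> writes every tensor of the network as
  \<open>\<Sum>b<r e. P b \<cdot> Q b\<close>, where \<open>P\<close> and \<open>Q\<close> are the contractions of the two components.  So the flattening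
  at \<open>e\<close> has rank at most \<open>r e\<close>, and if \<open>P\<close> or \<open>Q\<close> is linearly dependent then the local tensors at the
  ends of \<open>e\<close> can be changed so that bond dimension \<open>r e - 1\<close> suffices.  Hence, unless all bonds are 1,
  \<open>TNo\<close> consists of the tensors all of whose flattenings have rank exactly \<open>r e\<close>, an open condition on
  minors, and it is empty if some local tensor is forced to be dependent along one of its edges, that is,
  if \<open>r\<close> is not admissible.  If \<open>r\<close> is admissible, a generic choice makes every local tensor independent
  along each of its edges; independence passes to \<open>P\<close> and \<open>Q\<close> by growing the component from the end of
  \<open>e\<close> one vertex at a time, each new vertex being attached by a single edge.  Density holds because
  \<open>TN\<close> is the image of an affine space over an infinite field under a polynomial map.\<close>

section \<open>Independence and minors\<close>

definition sample_mat :: "nat \<Rightarrow> (nat \<Rightarrow> 'x \<Rightarrow> 'k) \<Rightarrow> (nat \<Rightarrow> 'x) \<Rightarrow> 'k mat" where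
  "sample_mat m f a = mat m m (\<lambda>(p, b). f b (a p))"

text \<open>Stated for an indexed family, so equal members count as dependent.\<close>

definition indep_on :: "'x set \<Rightarrow> nat \<Rightarrow> (nat \<Rightarrow> 'x \<Rightarrow> 'k::comm_ring_1) \<Rightarrow> bool" where
  "indep_on X m f \<longleftrightarrow> (\<forall>c. (\<forall>x\<in>X. (\<Sum>b<m. c b * f b x) = 0) \<longrightarrow> (\<forall>b<m. c b = 0))"

lemma sample_mat_carrier [simp]: "sample_mat m f a \<in> carrier_mat m m"
  by (simp add: sample_mat_def)

text \<open>Sample points are added one at a time. As a function of the last point, the determinant
  is a linear combination of the \<open>f b\<close> whose coefficient at \<open>f m\<close> is, up
  to sign, the previous nonzero determinant; independence gives a point where it does not
  vanish.\<close>

lemma indep_on_imp_det_nonzero: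
  fixes f :: "nat \<Rightarrow> 'x \<Rightarrow> 'k::comm_ring_1"
  assumes "indep_on X m f"
  shows "\<exists>a. (\<forall>p<m. a p \<in> X) \<and> det (sample_mat m f a) \<noteq> 0"
  using assms
proof (induction m)
  case 0
  then show ?case by (simp add: det_dim_zero[OF sample_mat_carrier])
next
  case (Suc m)
  have "indep_on X m f"
    unfolding indep_on_def
  proof (intro allI impI)
    fix c b
    assume c: "\<forall>x\<in>X. (\<Sum>b<m. c b * f b x) = 0" and b: "b < m"
    have "\<forall>x\<in>X. (\<Sum>b<Suc m. (c(m := 0)) b * f b x) = 0"
      using c by (auto intro!: sum.cong)
    then have "(c(m := 0)) b = 0"
      using Suc.prems b unfolding indep_on_def by (meson less_SucI)
    then show "c b = 0" using b by simp
  qed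
  then obtain a where a: "\<forall>p<m. a p \<in> X" and det_a: "det (sample_mat m f a) \<noteq> 0"
    using Suc.IH by blast
  \<comment> \<open>\<open>N b\<close> is the minor left after deleting the last row and column
    \<open>b\<close>. It does not involve the new point \<open>x\<close>, so the cofactors
    \<open>c b\<close> are constants.\<close>
  define N where "N b = mat m m (\<lambda>(p, q). f (if q < b then q else Suc q) (a p))" for b
  define c where "c b = (-1) ^ (m + b) * det (N b)" for b
  have expand: "det (sample_mat (Suc m) f (a(m := x))) = (\<Sum>b<Suc m. c b * f b x)" for x
  proof -
    let ?M = "sample_mat (Suc m) f (a(m := x))"
    have "mat_delete ?M m b = N b" if "b < Suc m" for b
      using that by (auto simp: mat_delete_def N_def sample_mat_def intro!: eq_matI)
    then have "?M $$ (m, b) * cofactor ?M m b = c b * f b x" if "b < Suc m" for b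
      using that by (simp add: cofactor_def c_def sample_mat_def mult.commute)
    then show ?thesis
      by (subst laplace_expansion_row[OF sample_mat_carrier, of m]) auto
  qed
  have "N m = sample_mat m f a"
    by (auto simp: N_def sample_mat_def intro!: eq_matI)
  then have "c m \<noteq> 0"
    using det_a by (cases "even m") (auto simp: c_def)
  then obtain x where "x \<in> X" "(\<Sum>b<Suc m. c b * f b x) \<noteq> 0"
    using Suc.prems unfolding indep_on_def by blast
  then have "\<forall>p<Suc m. (a(m := x)) p \<in> X" "det (sample_mat (Suc m) f (a(m := x))) \<noteq> 0"
    using a by (simp add: less_Suc_eq, simp only: expand not_False_eq_True)
  then show ?case by blast
qed

text \<open>A relation among the functions is a kernel vector of the sample matrix.\<close>

lemma det_nonzero_imp_indep_on:
  fixes f :: "nat \<Rightarrow> 'x \<Rightarrow> 'k::field"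
  assumes a: "\<forall>p<m. a p \<in> X" and det_a: "det (sample_mat m f a) \<noteq> 0"
  shows "indep_on X m f"
  unfolding indep_on_def
proof (intro allI impI)
  fix c b
  assume c: "\<forall>x\<in>X. (\<Sum>b<m. c b * f b x) = 0" and b: "b < m"
  have "sample_mat m f a *\<^sub>v vec m c = 0\<^sub>v m"
    using c a by (auto simp: sample_mat_def scalar_prod_def mult.commute atLeast0LessThan)
  then have "vec m c = 0\<^sub>v m"
    using det_a det_0_iff_vec_prod_zero_field[OF sample_mat_carrier, of m f a]
    by (metis vec_carrier)
  then show "c b = 0"
    using b by (metis index_vec index_zero_vec(1))
qed

text \<open>A repeated sample point would produce two equal rows, so \<open>a\<close> must be
  injective.\<close>

lemma indep_on_le_card:
  fixes f :: "nat \<Rightarrow> 'x \<Rightarrow> 'k::comm_ring_1"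
  assumes "indep_on X m f" "finite X"
  shows "m \<le> card X"
proof -
  obtain a where a: "\<forall>p<m. a p \<in> X" and det_a: "det (sample_mat m f a) \<noteq> 0"
    using indep_on_imp_det_nonzero[OF assms(1)] by blast
  have "inj_on a {..<m}"
  proof (rule inj_onI, rule ccontr)
    fix p q
    assume *: "p \<in> {..<m}" "q \<in> {..<m}" "a p = a q" "p \<noteq> q"
    have "row (sample_mat m f a) p = row (sample_mat m f a) q"
      using * by (auto simp: sample_mat_def)
    then show False
      using det_a det_identical_rows[OF sample_mat_carrier, of p q m f a] * by auto
  qed
  then show ?thesis
    using a assms(2) card_inj_on_le[of a "{..<m}" X] by auto
qed

text \<open>Both factors are padded with zeros to square matrices so that the determinant is
  multiplicative; column \<open>s\<close> of the left factor is then zero.\<close>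

lemma det_factor_small:
  fixes P Q :: "nat \<Rightarrow> nat \<Rightarrow> 'k::comm_ring_1"
  assumes "s < m"
  shows "det (mat m m (\<lambda>(p, q). \<Sum>b<s. P b p * Q b q)) = 0"
proof -
  let ?A = "mat m m (\<lambda>(p, b). if b < s then P b p else 0)"
  let ?B = "mat m m (\<lambda>(b, q). if b < s then Q b q else 0)"
  have "mat m m (\<lambda>(p, q). \<Sum>b<s. P b p * Q b q) = ?A * ?B"
  proof (rule eq_matI)
    fix p q
    assume "p < dim_row (?A * ?B)" "q < dim_col (?A * ?B)"
    then have *: "p < m" "q < m" by auto
    have "(?A * ?B) $$ (p, q) = (\<Sum>b<m. if b < s then P b p * Q b q else 0)"
      using * by (auto simp: scalar_prod_def atLeast0LessThan intro!: sum.cong)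
    also have "\<dots> = (\<Sum>b<s. P b p * Q b q)"
      using assms by (intro sum.mono_neutral_cong_right) auto
    finally show "mat m m (\<lambda>(p, q). \<Sum>b<s. P b p * Q b q) $$ (p, q) = (?A * ?B) $$ (p, q)"
      using * by simp
  qed auto
  moreover have "det ?A = 0"
    using assms
    by (subst laplace_expansion_column[of _ m s]) (auto intro!: sum.neutral)
  ultimately show ?thesis
    by (simp add: det_mult[of _ m])
qed

text \<open>Lets a minor of a flattening be nonzero as soon as one sample determinant on each side
  is nonzero.\<close>

lemma det_factor:
  fixes P :: "nat \<Rightarrow> 'x \<Rightarrow> 'k::comm_ring_1" and Q :: "nat \<Rightarrow> 'y \<Rightarrow> 'k"
  shows "det (mat m m (\<lambda>(p, q). \<Sum>b<m. P b (x p) * Q b (y q)))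
    = det (sample_mat m P x) * det (sample_mat m Q y)"
proof -
  have "mat m m (\<lambda>(p, q). \<Sum>b<m. P b (x p) * Q b (y q))
      = sample_mat m P x * transpose_mat (sample_mat m Q y)"
    by (rule eq_matI)
      (auto simp: sample_mat_def scalar_prod_def atLeast0LessThan intro!: sum.cong)
  then show ?thesis
    by (simp add: det_mult[of _ m] det_transpose[OF sample_mat_carrier])
qed

text \<open>A linear relation among the \<open>P b\<close> eliminates one term \<open>P b0\<close>.  The matrices are chosen before \<open>Q\<close>
  because they depend on the relation only.\<close>

lemma dependent_reduce:
  fixes P :: "nat \<Rightarrow> 'x \<Rightarrow> 'k::field"
  assumes "\<not> indep_on X m P"
  shows "\<exists>W W' :: nat \<Rightarrow> nat \<Rightarrow> 'k. \<forall>x\<in>X. \<forall>Q. (\<Sum>b<m. P b x * Q b)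
    = (\<Sum>a<m - 1. (\<Sum>b<m. W a b * P b x) * (\<Sum>b<m. W' a b * Q b))"
proof -
  obtain c b0 where c: "\<forall>x\<in>X. (\<Sum>b<m. c b * P b x) = 0" and b0: "b0 < m" "c b0 \<noteq> 0"
    using assms unfolding indep_on_def by blast
  \<comment> \<open>Enumerates the indices other than \<open>b0\<close> by putting the last index
    \<open>m - 1\<close> into the gap at \<open>b0\<close>. If \<open>b0 = m - 1\<close>, the
    exceptional case is never met.\<close>
  define \<sigma> where "\<sigma> a = (if a = b0 then m - 1 else a)" for a
  have bij: "bij_betw \<sigma> {..<m - 1} ({..<m} - {b0})"
  proof -
    obtain k where m: "m = Suc k" using b0(1) by (cases m) auto
    show ?thesis
    proof (rule bij_betwI[where g = "\<lambda>a. if a = k then b0 else a"])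
      show "\<sigma> \<in> {..<m - 1} \<rightarrow> {..<m} - {b0}"
        using b0(1) unfolding m by (auto simp: \<sigma>_def m)
      show "(\<lambda>a. if a = k then b0 else a) \<in> {..<m} - {b0} \<rightarrow> {..<m - 1}"
        using b0(1) unfolding m by (auto simp: less_Suc_eq)
    qed (auto simp: \<sigma>_def m)
  qed
  \<comment> \<open>\<open>W\<close> picks \<open>P (\<sigma> a)\<close>; \<open>W'\<close> adds to
    \<open>Q (\<sigma> a)\<close> the multiple of \<open>Q b0\<close> that appears when
    \<open>P b0\<close> is expressed through the other \<open>P b\<close>.\<close>
  define W where "W a b = (if b = \<sigma> a then 1 else 0 :: 'k)" for a b
  define W' where "W' a b = W a b + (if b = b0 then - (c (\<sigma> a) / c b0) else 0)" for a b
  have "(\<Sum>b<m. P b x * Q b)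
      = (\<Sum>a<m - 1. (\<Sum>b<m. W a b * P b x) * (\<Sum>b<m. W' a b * Q b))"
    if x: "x \<in> X" for x Q
  proof -
    have rm: "(\<Sum>b<m. h b) = h b0 + (\<Sum>b\<in>{..<m} - {b0}. h b)" for h :: "nat \<Rightarrow> 'k"
      using b0 by (intro sum.remove) auto
    have "c b0 * P b0 x = - (\<Sum>b\<in>{..<m} - {b0}. c b * P b x)"
      using c x rm[of "\<lambda>b. c b * P b x"] by (simp add: eq_neg_iff_add_eq_0)
    then have "P b0 x = - (\<Sum>b\<in>{..<m} - {b0}. c b * P b x) / c b0"
      using b0(2) by (metis nonzero_mult_div_cancel_left)
    also have "\<dots> = (\<Sum>b\<in>{..<m} - {b0}. - (c b / c b0) * P b x)"
      by (simp add: sum_divide_distrib sum_negf)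
    finally have P0: "P b0 x = (\<Sum>b\<in>{..<m} - {b0}. - (c b / c b0) * P b x)" .
    have "(\<Sum>b<m. P b x * Q b) = P b0 x * Q b0 + (\<Sum>b\<in>{..<m} - {b0}. P b x * Q b)"
      by (rule rm)
    also have "\<dots> = (\<Sum>b\<in>{..<m} - {b0}. - (c b / c b0) * P b x * Q b0 + P b x * Q b)"
      unfolding P0 sum_distrib_right sum.distrib ..
    also have "\<dots> = (\<Sum>b\<in>{..<m} - {b0}. P b x * (Q b + - (c b / c b0) * Q b0))"
      by (intro sum.cong refl) (simp add: algebra_simps)
    also have "\<dots> = (\<Sum>a<m - 1. P (\<sigma> a) x * (Q (\<sigma> a) + - (c (\<sigma> a) / c b0) * Q b0))"
      by (rule sum.reindex_bij_betw[OF bij, symmetric])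
    also have "\<dots> = (\<Sum>a<m - 1. (\<Sum>b<m. W a b * P b x) * (\<Sum>b<m. W' a b * Q b))"
    proof (rule sum.cong[OF refl])
      fix a assume "a \<in> {..<m - 1}"
      then have \<sigma>: "\<sigma> a < m" using bij by (auto simp: bij_betw_def)
      have pick: "(\<Sum>b<m. (if b = t then z else 0) * h b) = z * h t" if "t < m" for t z and h :: "nat \<Rightarrow> 'k"
        using that by (subst sum.mono_neutral_cong_right[of _ "{t}" _ "\<lambda>b. z * h b"]) auto
      show "P (\<sigma> a) x * (Q (\<sigma> a) + - (c (\<sigma> a) / c b0) * Q b0)
          = (\<Sum>b<m. W a b * P b x) * (\<Sum>b<m. W' a b * Q b)"
        unfolding W'_def W_def distrib_right sum.distrib pick[OF \<sigma>] pick[OF b0(1)] by simp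
    qed
    finally show ?thesis .
  qed
  then show ?thesis by blast
qed

section \<open>Polynomial functions and generic points over an infinite field\<close>

section \<open>Polynomial functions\<close>

lemma polyfun_sum:
  "finite I \<Longrightarrow> (\<And>i. i \<in> I \<Longrightarrow> p i \<in> polyfun C) \<Longrightarrow> (\<lambda>v. \<Sum>i\<in>I. p i v) \<in> polyfun C"
  by (induction I rule: finite_induct) (auto intro: polyfun.intros)

lemma polyfun_prod:
  "finite I \<Longrightarrow> (\<And>i. i \<in> I \<Longrightarrow> p i \<in> polyfun C) \<Longrightarrow> (\<lambda>v. \<Prod>i\<in>I. p i v) \<in> polyfun C"
  by (induction I rule: finite_induct) (auto intro: polyfun.intros)

lemma polyfun_det:
  assumes "\<And>p q. p < m \<Longrightarrow> q < m \<Longrightarrow> M p q \<in> polyfun C"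
  shows "(\<lambda>v. det (mat m m (\<lambda>(p, q). M p q v))) \<in> polyfun C"
proof -
  have "(\<lambda>v. \<Sum>\<pi> | \<pi> permutes {0..<m}. signof \<pi> * (\<Prod>i = 0..<m. M i (\<pi> i) v)) \<in> polyfun C"
  proof (intro polyfun_sum polyfun.mult[OF polyfun.const] polyfun_prod)
    show "finite {\<pi>. \<pi> permutes {0..<m}}" by (simp add: finite_permutations)
  next
    fix \<pi> i assume "\<pi> \<in> {\<pi>. \<pi> permutes {0..<m}}" "i \<in> {0..<m}"
    then show "M i (\<pi> i) \<in> polyfun C"
      using permutes_in_image[of \<pi> "{0..<m}" i] by (intro assms) auto
  qed simp
  also have "(\<lambda>v. \<Sum>\<pi> | \<pi> permutes {0..<m}. signof \<pi> * (\<Prod>i = 0..<m. M i (\<pi> i) v))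
      = (\<lambda>v. det (mat m m (\<lambda>(p, q). M p q v)))"
    by (rule ext, subst det_def'[of _ m])
      (auto intro!: sum.cong prod.cong simp: permutes_in_image)
  finally show ?thesis .
qed

lemma polyfun_compose:
  assumes "p \<in> polyfun C" "\<And>c. c \<in> C \<Longrightarrow> (\<lambda>u. \<phi> u c) \<in> polyfun D"
  shows "(\<lambda>u. p (\<phi> u)) \<in> polyfun D"
  using assms(1) by induction (auto intro: polyfun.intros assms(2))

text \<open>Restriction to a line reduces questions of nonvanishing to univariate polynomials,
  whatever the coordinate set \<open>C\<close>.\<close>

lemma polyfun_on_line:
  fixes p :: "('c \<Rightarrow> 'k::comm_ring_1) \<Rightarrow> 'k"
  assumes "p \<in> polyfun C"
  shows "\<exists>g. \<forall>s. p (\<lambda>c. u c + s * (w c - u c)) = poly g s"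
  using assms
proof induction
  case (const a)
  then show ?case by (intro exI[of _ "[:a:]"]) simp
next
  case (coord c)
  then show ?case by (intro exI[of _ "[:u c, w c - u c:]"]) simp
next
  case (add p q)
  then show ?case by (metis poly_add)
next
  case (mult p q)
  then show ?case by (metis poly_mult)
qed

text \<open>On the line through \<open>u\<close> (at \<open>s = 0\<close>) and \<open>w\<close> (at
  \<open>s = 1\<close>) both restrictions are nonzero polynomials, so their product has finitely
  many roots. In effect, affine space is irreducible.\<close>

lemma polyfun_common_nonzero2:
  fixes p q :: "('c \<Rightarrow> 'k::field) \<Rightarrow> 'k"
  assumes "infinite (UNIV :: 'k set)"
    and p: "p \<in> polyfun C" "p u \<noteq> 0" and q: "q \<in> polyfun C" "q w \<noteq> 0"
  shows "\<exists>z. p z \<noteq> 0 \<and> q z \<noteq> 0"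
proof -
  obtain g h where g: "\<And>s. p (\<lambda>c. u c + s * (w c - u c)) = poly g s"
    and h: "\<And>s. q (\<lambda>c. u c + s * (w c - u c)) = poly h s"
    using polyfun_on_line[OF p(1)] polyfun_on_line[OF q(1)] by metis
  have "poly g 0 \<noteq> 0" "poly h 1 \<noteq> 0"
    using g[of 0] h[of 1] p(2) q(2) by auto
  then have "g * h \<noteq> 0" by auto
  then have "finite {s. poly (g * h) s = 0}" by (rule poly_roots_finite)
  then obtain s where "poly (g * h) s \<noteq> 0"
    using assms(1) by (metis (mono_tags, lifting) UNIV_eq_I mem_Collect_eq)
  then show ?thesis
    using g h by (metis mult_eq_0_iff poly_mult)
qed

lemma polyfun_common_nonzero:
  fixes p :: "'i \<Rightarrow> ('c \<Rightarrow> 'k::field) \<Rightarrow> 'k"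
  assumes inf: "infinite (UNIV :: 'k set)"
    and "finite I" "\<And>i. i \<in> I \<Longrightarrow> p i \<in> polyfun C" "\<And>i. i \<in> I \<Longrightarrow> \<exists>u. p i u \<noteq> 0"
  shows "\<exists>z. \<forall>i\<in>I. p i z \<noteq> 0"
  using assms(2-4)
proof (induction I rule: finite_induct)
  case (insert i I)
  obtain z where "\<forall>i\<in>I. p i z \<noteq> 0" using insert by auto
  then have z: "(\<Prod>i\<in>I. p i z) \<noteq> 0" using insert by auto
  have "(\<lambda>z. \<Prod>i\<in>I. p i z) \<in> polyfun C"
    using insert by (auto intro: polyfun_prod)
  then obtain z where "(\<Prod>i\<in>I. p i z) \<noteq> 0" "p i z \<noteq> 0"
    using polyfun_common_nonzero2[where p = "\<lambda>z. \<Prod>i\<in>I. p i z", OF inf] z insert.prems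
    by (metis insertI1)
  then show ?case using insert.hyps by auto
qed simp

section \<open>Subtrees\<close>

definition inner_edges :: "edge set \<Rightarrow> nat set \<Rightarrow> edge set" where
  "inner_edges F S = {f \<in> F. fst f \<in> S \<and> snd f \<in> S}"

definition joins :: "edge \<Rightarrow> nat \<Rightarrow> nat \<Rightarrow> bool" where
  "joins f u w \<longleftrightarrow> f = (u, w) \<or> f = (w, u)"

definition reach :: "edge set \<Rightarrow> nat \<Rightarrow> nat set" where
  "reach F u = {v. (u, v) \<in> (F \<union> F\<inverse>)\<^sup>*}"

text \<open>Connected vertex sets containing \<open>u\<close>, presented so that induction attaches
  one vertex \<open>k\<close> at a time through an edge \<open>f\<close> from inside.\<close>

inductive grown :: "edge set \<Rightarrow> nat \<Rightarrow> nat set \<Rightarrow> bool" for F u where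
  base: "grown F u {u}"
| step: "grown F u S \<Longrightarrow> f \<in> F \<Longrightarrow> joins f l k \<Longrightarrow> l \<in> S \<Longrightarrow> k \<notin> S \<Longrightarrow> grown F u (insert k S)"

lemma joins_sym: "joins f u w \<longleftrightarrow> joins f w u"
  by (auto simp: joins_def)

lemma grown_mono: "grown F u S \<Longrightarrow> F \<subseteq> F' \<Longrightarrow> grown F' u S"
  by (induction rule: grown.induct) (auto intro: grown.intros)

lemma grown_finite: "grown F u S \<Longrightarrow> finite S"
  by (induction rule: grown.induct) auto

lemma grown_root: "grown F u S \<Longrightarrow> u \<in> S"
  by (induction rule: grown.induct) auto

lemma reach_step: "l \<in> reach F u \<Longrightarrow> f \<in> F \<Longrightarrow> joins f l k \<Longrightarrow> k \<in> reach F u"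
  unfolding reach_def joins_def by (auto intro: rtrancl_into_rtrancl)

lemma reach_self: "u \<in> reach F u"
  by (simp add: reach_def)

lemma grown_subset_reach: "grown F u S \<Longrightarrow> S \<subseteq> reach F u"
  by (induction rule: grown.induct) (auto intro: reach_step reach_self)

lemma reach_subset_closed:
  assumes "u \<in> S" "\<And>f l k. f \<in> F \<Longrightarrow> joins f l k \<Longrightarrow> l \<in> S \<Longrightarrow> k \<in> S"
  shows "reach F u \<subseteq> S"
proof
  fix v assume "v \<in> reach F u"
  then have "(u, v) \<in> (F \<union> F\<inverse>)\<^sup>*" by (simp add: reach_def)
  then show "v \<in> S"
    by induction (use assms in \<open>auto simp: joins_def\<close>)
qed

lemma reach_sym: "v \<in> reach F u \<Longrightarrow> u \<in> reach F v"
proof -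
  have "sym ((F \<union> F\<inverse>)\<^sup>*)" by (intro sym_rtrancl sym_Un_converse)
  then show "v \<in> reach F u \<Longrightarrow> u \<in> reach F v"
    by (auto simp: reach_def dest: symD)
qed

lemma reach_trans: "v \<in> reach F u \<Longrightarrow> w \<in> reach F v \<Longrightarrow> w \<in> reach F u"
  by (auto simp: reach_def)

lemma joins_inner_edges:
  assumes "f \<in> F" "joins f l k" "l \<in> S" "k \<notin> S" "finite F"
  shows "insert f (inner_edges F S) \<subseteq> inner_edges F (insert k S)" "f \<notin> inner_edges F S"
    "card (inner_edges F S) + 1 \<le> card (inner_edges F (insert k S))"
proof -
  show *: "insert f (inner_edges F S) \<subseteq> inner_edges F (insert k S)" and **: "f \<notin> inner_edges F S"
    using assms by (auto simp: inner_edges_def joins_def)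
  have fin: "finite (inner_edges F S)" for S using assms by (auto simp: inner_edges_def)
  show "card (inner_edges F S) + 1 \<le> card (inner_edges F (insert k S))"
    using card_mono[OF fin *] ** fin by simp
qed

text \<open>Every growth step adds one vertex and at least one inner edge.\<close>

lemma grown_card_le: "grown F u S \<Longrightarrow> finite F \<Longrightarrow> card S \<le> card (inner_edges F S) + 1"
proof (induction rule: grown.induct)
  case (step S f l k)
  then show ?case
    using joins_inner_edges(3)[of f F l k S] grown_finite[of F u S] by simp
qed simp

text \<open>The number of vertices minus the number of inner edges cannot increase during growth,
  and growth is stuck only at \<open>reach F u\<close>. Starting from an arbitrary grown
  \<open>S\<close> is what bounds its inner edges from above in \<open>grown_card\<close>.\<close>

lemma grown_reach:
  assumes "finite F" "finite (reach F u)" "grown F u S"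
  shows "grown F u (reach F u)
    \<and> card (inner_edges F S) + card (reach F u) \<le> card (inner_edges F (reach F u)) + card S"
  using assms(3)
proof (induction "card (reach F u - S)" arbitrary: S rule: less_induct)
  case less
  show ?case
  proof (cases "S = reach F u")
    case True
    then show ?thesis using less.prems by simp
  next
    case False
    then have "\<not> reach F u \<subseteq> S" using grown_subset_reach[OF less.prems] by blast
    then obtain f l k where f: "f \<in> F" "joins f l k" "l \<in> S" "k \<notin> S"
      using reach_subset_closed[of u S F] grown_root[OF less.prems] by blast
    have gr: "grown F u (insert k S)" using less.prems f by (rule grown.step)
    then have "k \<in> reach F u" using grown_subset_reach by blast
    then have "card (reach F u - insert k S) < card (reach F u - S)"
      using f assms(2) by (intro psubset_card_mono) auto
    then have "grown F u (reach F u) \<and> card (inner_edges F (insert k S)) + card (reach F u)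
        \<le> card (inner_edges F (reach F u)) + card (insert k S)"
      using less.hyps gr by blast
    then show ?thesis
      using joins_inner_edges(3)[OF f assms(1)] f grown_finite[OF less.prems] by simp
  qed
qed

section \<open>Trees by edge counting\<close>

locale tree =
  fixes d :: nat and E :: "edge set"
  assumes tree: "tree_graph d E"
begin

lemma d_pos: "0 < d" and E_subset: "E \<subseteq> {0..<d} \<times> {0..<d}"
  and no_loop: "f \<in> E \<Longrightarrow> fst f \<noteq> snd f" and card_E: "card E + 1 = d"
  and reach_E: "u < d \<Longrightarrow> v < d \<Longrightarrow> v \<in> reach E u"
  using tree unfolding tree_graph_def reach_def by auto

lemma finite_E [simp]: "finite E"
  using E_subset finite_subset by blast

lemma joins_less: "f \<in> E \<Longrightarrow> joins f u w \<Longrightarrow> u < d \<and> w < d"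
  using E_subset by (auto simp: joins_def)

lemma joins_neq: "f \<in> E \<Longrightarrow> joins f u w \<Longrightarrow> u \<noteq> w"
  using no_loop[of f] by (auto simp: joins_def)

lemma reach_subset: "F \<subseteq> E \<Longrightarrow> u < d \<Longrightarrow> reach F u \<subseteq> {..<d}"
  using joins_less by (intro reach_subset_closed) auto

lemma reach_E_eq: "u < d \<Longrightarrow> reach E u = {..<d}"
  using reach_subset[of E u] reach_E by blast

lemma inner_edges_all: "inner_edges E {..<d} = E"
  using E_subset by (auto simp: inner_edges_def)

lemma finite_inner_edges [simp]: "finite (inner_edges E S)"
  by (simp add: inner_edges_def)

text \<open>The bound \<open>grown_card_le\<close> is met by the opposite one: growing
  \<open>S\<close> to all \<open>d\<close> vertices ends with only \<open>d - 1\<close> edges. This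
  is the form in which acyclicity is used.\<close>

lemma grown_card:
  assumes "grown E u S" "u < d"
  shows "card S = card (inner_edges E S) + 1"
  using grown_card_le[OF assms(1)] grown_reach[OF finite_E _ assms(1)] card_E
  by (simp add: reach_E_eq[OF assms(2)] inner_edges_all)

text \<open>One inclusion is clear and both sides have \<open>card S\<close> elements. So a new
  vertex is attached by exactly one edge.\<close>

lemma inner_edges_insert:
  assumes S: "grown E u S" "u < d" and f: "f \<in> E" "joins f l k" "l \<in> S" "k \<notin> S"
  shows "inner_edges E (insert k S) = insert f (inner_edges E S)"
proof -
  have "grown E u (insert k S)" using S(1) f by (rule grown.step)
  then have "card (inner_edges E (insert k S)) = card S"
    using grown_card[of u "insert k S"] S f grown_finite[OF S(1)] by simp
  also have "\<dots> = card (insert f (inner_edges E S))"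
    using grown_card[OF S] joins_inner_edges(2)[OF f] by simp
  finally show ?thesis
    using joins_inner_edges(1)[OF f] by (intro card_subset_eq[symmetric]) auto
qed

lemma incident_disjoint:
  assumes S: "grown E u S" "u < d" and f: "f \<in> E" "joins f l k" "l \<in> S" "k \<notin> S"
    and g: "g \<in> incident E k" "g \<in> incident E m" "m \<in> S"
  shows "g = f"
proof -
  have "g \<in> inner_edges E (insert k S)" "g \<notin> inner_edges E S"
    using g f no_loop[of g] by (auto simp: incident_def inner_edges_def)
  then show ?thesis using inner_edges_insert[OF S f] by blast
qed

end

section \<open>Cutting a tree at one edge\<close>

definition component :: "edge set \<Rightarrow> edge \<Rightarrow> nat \<Rightarrow> nat set" where
  "component E e u = reach (E - {e}) u"

locale tree_edge = tree +
  fixes e u w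
  assumes e: "e \<in> E" "joins e u w"
begin

lemma u_less: "u < d" and u_neq_w: "u \<noteq> w"
  using joins_less[OF e] joins_neq[OF e] by auto

text \<open>Transfers every fact about the side of \<open>u\<close> to the side of
  \<open>w\<close>.\<close>

lemma swap: "tree_edge d E e w u"
  using e by unfold_locales (auto simp: joins_sym)

lemma component_subset: "component E e u \<subseteq> {..<d}"
  unfolding component_def by (rule reach_subset) (use u_less in auto)

lemma finite_component [simp]: "finite (component E e u)"
  using component_subset finite_subset by blast

lemma grown_component: "grown (E - {e}) u (component E e u)"
  using grown_reach[of "E - {e}" u "{u}"] finite_component grown.base unfolding component_def by auto

lemma root_component: "u \<in> component E e u"
  by (simp add: component_def reach_self)

text \<open>If \<open>w\<close> were still reachable, the component would have the inner edge
  \<open>e\<close> besides the edges by which it was grown in \<open>E - {e}\<close>, one more than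
  \<open>grown_card\<close> allows.\<close>

lemma not_in_component: "w \<notin> component E e u"
proof
  let ?C = "component E e u"
  assume w: "w \<in> ?C"
  have "e \<in> inner_edges E ?C" "inner_edges (E - {e}) ?C = inner_edges E ?C - {e}"
    using w root_component e by (auto simp: inner_edges_def joins_def)
  then have "card (inner_edges (E - {e}) ?C) < card (inner_edges E ?C)"
    by (metis card_Diff1_less finite_inner_edges)
  moreover have "card ?C = card (inner_edges E ?C) + 1"
    using grown_component u_less by (intro grown_card) (auto intro: grown_mono)
  ultimately show False
    using grown_card_le[OF grown_component] by simp
qed

lemma component_closed: "f \<in> E \<Longrightarrow> f \<noteq> e \<Longrightarrow> fst f \<in> component E e u \<longleftrightarrow> snd f \<in> component E e u"
  unfolding component_def
  using reach_step[of _ "E - {e}" u f] by (cases f) (auto simp: joins_def)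

lemma component_disjoint: "component E e u \<inter> component E e w = {}"
  using not_in_component unfolding component_def by (blast dest: reach_sym reach_trans)

text \<open>The union is closed under crossing any edge, \<open>e\<close> included, so it contains
  everything reachable from \<open>u\<close>.\<close>

lemma component_union: "component E e u \<union> component E e w = {..<d}"
proof -
  interpret sw: tree_edge d E e w u by (rule swap)
  have "reach E u \<subseteq> component E e u \<union> component E e w"
  proof (rule reach_subset_closed)
    fix f l k
    assume *: "f \<in> E" "joins f l k" "l \<in> component E e u \<union> component E e w"
    show "k \<in> component E e u \<union> component E e w"
    proof (cases "f = e")
      case True
      then show ?thesis using * e root_component sw.root_component by (auto simp: joins_def)
    next
      case False
      then show ?thesis
        using * component_closed[of f] sw.component_closed[of f] by (auto simp: joins_def)
    qed
  qed (simp add: root_component)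
  then show ?thesis
    using component_subset sw.component_subset reach_E_eq[OF u_less] by auto
qed

lemma e_not_inner: "e \<notin> inner_edges E (component E e u)"
  using not_in_component e by (auto simp: inner_edges_def joins_def)

lemma E_split: "E = insert e (inner_edges E (component E e u) \<union> inner_edges E (component E e w))"
proof -
  interpret sw: tree_edge d E e w u by (rule swap)
  have "f \<in> inner_edges E (component E e u) \<union> inner_edges E (component E e w)"
    if f: "f \<in> E" "f \<noteq> e" for f
  proof -
    have "fst f \<in> component E e u \<union> component E e w"
      using f E_subset component_union by fastforce
    then show ?thesis
      using component_closed[OF f] sw.component_closed[OF f] f by (auto simp: inner_edges_def)
  qed
  then show ?thesis using e by (auto simp: inner_edges_def)
qed

lemma incident_component:
  "l \<in> component E e u \<Longrightarrow> incident E l \<subseteq> insert e (inner_edges E (component E e u))"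
  using component_closed by (auto simp: incident_def inner_edges_def)

lemma e_incident_component:
  "l \<in> component E e u \<Longrightarrow> e \<in> incident E l \<longleftrightarrow> l = u"
  using not_in_component e by (auto simp: incident_def joins_def)

end

section \<open>Partial contractions\<close>

text \<open>\<open>F\<close> is the set of edges summed over; the bond indices of all other edges are read from \<open>\<gamma>\<close>.\<close>

definition pcontract :: "edge set \<Rightarrow> (edge \<Rightarrow> nat) \<Rightarrow> (nat \<Rightarrow> (edge \<Rightarrow> nat) \<Rightarrow> nat \<Rightarrow> 'k::comm_semiring_1)
    \<Rightarrow> edge set \<Rightarrow> nat set \<Rightarrow> (edge \<Rightarrow> nat) \<Rightarrow> (nat \<Rightarrow> nat) \<Rightarrow> 'k" where
  "pcontract E r T F A \<gamma> x =
    (\<Sum>\<beta>\<in>bond_assign F r. \<Prod>l\<in>A. T l (restrict (override_on \<gamma> \<beta> F) (incident E l)) (x l))"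

lemma pcontract_cong:
  assumes "\<And>l. l \<in> A \<Longrightarrow> T l = T' l" "\<And>f. f \<in> F \<Longrightarrow> r f = r' f" "\<And>l. l \<in> A \<Longrightarrow> x l = x' l"
    and "\<And>l g. l \<in> A \<Longrightarrow> g \<in> incident E l \<Longrightarrow> g \<notin> F \<Longrightarrow> \<gamma> g = \<gamma>' g"
  shows "pcontract E r T F A \<gamma> x = pcontract E r' T' F A \<gamma>' x'"
proof -
  have "bond_assign F r = bond_assign F r'"
    using assms(2) by (auto simp: bond_assign_def intro!: PiE_cong)
  moreover have "restrict (override_on \<gamma> \<beta> F) (incident E l) = restrict (override_on \<gamma>' \<beta> F) (incident E l)"
    if "l \<in> A" for l \<beta>
    using assms(4)[OF that] by (auto simp: restrict_def override_on_def)
  ultimately show ?thesis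
    using assms(1,3) by (auto simp: pcontract_def intro!: sum.cong prod.cong)
qed

text \<open>Fubini for the bond index of \<open>f\<close>, which is moved into the base
  assignment.\<close>

lemma pcontract_insert_edge:
  assumes "finite F" "f \<notin> F"
  shows "pcontract E r T (insert f F) A \<gamma> x = (\<Sum>b<r f. pcontract E r T F A (\<gamma>(f := b)) x)"
proof -
  let ?h = "\<lambda>\<gamma>. \<Prod>l\<in>A. T l (restrict \<gamma> (incident E l)) (x l)"
  have ov: "override_on \<gamma> (\<beta>(f := b)) (insert f F) = override_on (\<gamma>(f := b)) \<beta> F" for b \<beta>
    using assms(2) by (auto simp: override_on_def)
  have "bond_assign (insert f F) r = (\<lambda>(b, \<beta>). \<beta>(f := b)) ` ({0..<r f} \<times> bond_assign F r)"
    by (simp add: bond_assign_def PiE_insert_eq)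
  moreover have "inj_on (\<lambda>(b, \<beta>). \<beta>(f := b)) ({0..<r f} \<times> bond_assign F r)"
    unfolding bond_assign_def using assms(2) by (rule inj_combinator)
  ultimately have "pcontract E r T (insert f F) A \<gamma> x
      = (\<Sum>(b, \<beta>)\<in>{0..<r f} \<times> bond_assign F r. ?h (override_on \<gamma> (\<beta>(f := b)) (insert f F)))"
    unfolding pcontract_def by (simp add: sum.reindex case_prod_unfold)
  also have "\<dots> = (\<Sum>b<r f. pcontract E r T F A (\<gamma>(f := b)) x)"
    unfolding pcontract_def ov by (simp add: sum.cartesian_product atLeast0LessThan)
  finally show ?thesis .
qed

lemma pcontract_no_edges:
  "pcontract E r T {} A \<gamma> x = (\<Prod>l\<in>A. T l (restrict \<gamma> (incident E l)) (x l))"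
  by (simp add: pcontract_def bond_assign_def override_on_def)

lemma pcontract_union_vertices:
  assumes "finite A" "finite B" "A \<inter> B = {}" "\<And>l. l \<in> A \<Longrightarrow> incident E l \<inter> F = {}"
  shows "pcontract E r T F (A \<union> B) \<gamma> x = pcontract E r T {} A \<gamma> x * pcontract E r T F B \<gamma> x"
proof -
  have "restrict (override_on \<gamma> \<beta> F) (incident E l) = restrict \<gamma> (incident E l)" if "l \<in> A" for l \<beta>
    using assms(4)[OF that] by (auto simp: restrict_def override_on_def fun_eq_iff)
  then have "(\<Prod>l\<in>A. T l (restrict (override_on \<gamma> \<beta> F) (incident E l)) (x l))
      = (\<Prod>l\<in>A. T l (restrict \<gamma> (incident E l)) (x l))" for \<beta>
    by (auto intro: prod.cong)
  then show ?thesis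
    using assms(1-3)
    by (simp add: pcontract_no_edges) (simp add: pcontract_def prod.union_disjoint sum_distrib_left)
qed

text \<open>The edges of \<open>F\<close> are summed one after another; no vertex of
  \<open>B\<close> meets them, so the factor of \<open>B\<close> stays constant.\<close>

lemma pcontract_union:
  assumes "finite F" "finite G" "finite A" "finite B" "A \<inter> B = {}" "F \<inter> G = {}"
    and "\<And>l. l \<in> A \<Longrightarrow> incident E l \<inter> G = {}" "\<And>l. l \<in> B \<Longrightarrow> incident E l \<inter> F = {}"
  shows "pcontract E r T (F \<union> G) (A \<union> B) \<gamma> x = pcontract E r T F A \<gamma> x * pcontract E r T G B \<gamma> x"
  using assms(1,6,8)
proof (induction F arbitrary: \<gamma> rule: finite_induct)
  case empty
  then show ?case using assms by (simp add: pcontract_union_vertices)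
next
  case (insert f F)
  have "pcontract E r T (insert f F \<union> G) (A \<union> B) \<gamma> x
      = (\<Sum>b<r f. pcontract E r T (F \<union> G) (A \<union> B) (\<gamma>(f := b)) x)"
    using insert assms(2) by (simp add: pcontract_insert_edge)
  also have "\<dots> = (\<Sum>b<r f. pcontract E r T F A (\<gamma>(f := b)) x * pcontract E r T G B \<gamma> x)"
  proof (intro sum.cong refl)
    fix b
    have "pcontract E r T G B (\<gamma>(f := b)) x = pcontract E r T G B \<gamma> x"
      using insert.prems by (intro pcontract_cong) auto
    then show "pcontract E r T (F \<union> G) (A \<union> B) (\<gamma>(f := b)) x
        = pcontract E r T F A (\<gamma>(f := b)) x * pcontract E r T G B \<gamma> x"
      using insert by auto
  qed
  also have "\<dots> = pcontract E r T (insert f F) A \<gamma> x * pcontract E r T G B \<gamma> x"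
    using insert by (simp add: pcontract_insert_edge sum_distrib_right)
  finally show ?case .
qed

lemma incident_subset: "incident E l \<subseteq> E"
  by (auto simp: incident_def)

lemma incident_inner_edges: "l \<notin> S \<Longrightarrow> incident E l \<inter> inner_edges E S = {}"
  by (auto simp: incident_def inner_edges_def)

lemma contract_eq_pcontract:
  assumes "x \<in> idx d n"
  shows "contract d n E r T x = pcontract E r T E {..<d} \<gamma> x"
proof -
  have "restrict (override_on \<gamma> \<beta> E) (incident E l) = restrict \<beta> (incident E l)" for l \<beta>
    using incident_subset[of E l] by (auto simp: restrict_def override_on_def fun_eq_iff)
  then show ?thesis using assms by (simp add: contract_def pcontract_def)
qed

section \<open>The two halves of a cut network\<close>

text \<open>\<open>e\<close> is the only edge leaving the component, so the base assignment \<open>\<lambda>_. 0\<close> is irrelevant.\<close>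

definition half :: "edge set \<Rightarrow> (edge \<Rightarrow> nat) \<Rightarrow> (nat \<Rightarrow> (edge \<Rightarrow> nat) \<Rightarrow> nat \<Rightarrow> 'k::comm_semiring_1)
    \<Rightarrow> edge \<Rightarrow> nat \<Rightarrow> nat \<Rightarrow> (nat \<Rightarrow> nat) \<Rightarrow> 'k" where
  "half E r T e u b x =
    pcontract E r T (inner_edges E (component E e u)) (component E e u) ((\<lambda>_. 0)(e := b)) x"

lemma half_cong:
  assumes "\<And>l. l \<in> component E e u \<Longrightarrow> x l = x' l"
  shows "half E r T e u b x = half E r T e u b x'"
  unfolding half_def using assms by (intro pcontract_cong) auto

context tree_edge
begin

lemma half_eq_pcontract:
  "half E r T e u b x
    = pcontract E r T (inner_edges E (component E e u)) (component E e u) (\<gamma>(e := b)) x"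
  unfolding half_def using incident_component by (intro pcontract_cong) auto

text \<open>With the index of \<open>e\<close> fixed, the two components share neither vertices nor
  summed edges, so the contraction factors. This is the factorization of the flattening through
  dimension \<open>r e\<close>.\<close>

lemma contract_split:
  fixes T :: "nat \<Rightarrow> (edge \<Rightarrow> nat) \<Rightarrow> nat \<Rightarrow> 'k::comm_semiring_1"
  assumes "x \<in> idx d n"
  shows "contract d n E r T x = (\<Sum>b<r e. half E r T e u b x * half E r T e w b x)"
proof -
  interpret sw: tree_edge d E e w u by (rule swap)
  let ?A = "component E e u" and ?B = "component E e w"
  have "contract d n E r T x = pcontract E r T E {..<d} (\<lambda>_. 0) x"
    using assms by (rule contract_eq_pcontract)
  also have "\<dots> = pcontract E r T (insert e (inner_edges E ?A \<union> inner_edges E ?B)) (?A \<union> ?B) (\<lambda>_. 0) x"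
    using E_split component_union by simp
  also have "\<dots> = (\<Sum>b<r e. pcontract E r T (inner_edges E ?A \<union> inner_edges E ?B) (?A \<union> ?B) ((\<lambda>_. 0)(e := b)) x)"
    using e_not_inner sw.e_not_inner by (intro pcontract_insert_edge) auto
  also have "\<dots> = (\<Sum>b<r e. half E r T e u b x * half E r T e w b x)"
  proof (intro sum.cong refl)
    fix b
    show "pcontract E r T (inner_edges E ?A \<union> inner_edges E ?B) (?A \<union> ?B) ((\<lambda>_. 0)(e := b)) x
        = half E r T e u b x * half E r T e w b x"
      unfolding half_def
    proof (rule pcontract_union)
      show "inner_edges E ?A \<inter> inner_edges E ?B = {}"
        using component_disjoint by (auto simp: inner_edges_def)
      show "incident E l \<inter> inner_edges E ?B = {}" if "l \<in> ?A" for l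
        using component_disjoint that by (intro incident_inner_edges) auto
      show "incident E l \<inter> inner_edges E ?A = {}" if "l \<in> ?B" for l
        using component_disjoint that by (intro incident_inner_edges) auto
    qed (use component_disjoint in auto)
  qed
  finally show ?thesis .
qed

text \<open>The half is linear in \<open>T u\<close>, and \<open>u\<close> is the only vertex of its
  component that meets \<open>e\<close>, so a matrix acting on that leg passes through the
  contraction. As \<open>e\<close> is not an inner edge, its bond dimension in \<open>r'\<close> is
  free.\<close>

lemma half_transform:
  fixes T :: "nat \<Rightarrow> (edge \<Rightarrow> nat) \<Rightarrow> nat \<Rightarrow> 'k::comm_semiring_1"
  assumes T'_u: "T' u = (\<lambda>\<gamma> y. \<Sum>b<m. W (\<gamma> e) b * T u (\<gamma>(e := b)) y)"
    and T': "\<And>l. l \<in> component E e u \<Longrightarrow> l \<noteq> u \<Longrightarrow> T' l = T l"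
    and r': "\<And>f. f \<in> E \<Longrightarrow> f \<noteq> e \<Longrightarrow> r' f = r f"
  shows "half E r' T' e u a x = (\<Sum>b<m. W a b * half E r T e u b x)"
proof -
  let ?C = "component E e u" and ?F = "inner_edges E (component E e u)"
  let ?h = "\<lambda>T b \<beta>. \<Prod>l\<in>?C. T l (restrict (override_on ((\<lambda>_. 0)(e := b)) \<beta> ?F) (incident E l)) (x l)"
  have "half E r' T' e u a x = pcontract E r T' ?F ?C ((\<lambda>_. 0)(e := a)) x"
    unfolding half_def using r' e_not_inner by (intro pcontract_cong) (auto simp: inner_edges_def)
  moreover have "?h T' a \<beta> = (\<Sum>b<m. W a b * ?h T b \<beta>)" for \<beta>
  proof -
    let ?g = "\<lambda>b. override_on ((\<lambda>_. 0)(e := b)) \<beta> ?F"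
    let ?rest = "\<lambda>T b. \<Prod>l\<in>?C - {u}. T l (restrict (?g b) (incident E l)) (x l)"
    have split: "?h T b \<beta> = T u (restrict (?g b) (incident E u)) (x u) * ?rest T b"
      for T :: "nat \<Rightarrow> (edge \<Rightarrow> nat) \<Rightarrow> nat \<Rightarrow> 'k" and b
      using root_component by (intro prod.remove) auto
    \<comment> \<open>No vertex of the component other than \<open>u\<close> sees the index of
      \<open>e\<close>.\<close>
    have rest: "?rest T' a = ?rest T b" for b
    proof (intro prod.cong refl)
      fix l assume l: "l \<in> ?C - {u}"
      then have "e \<notin> incident E l" using e_incident_component by auto
      then have "restrict (?g a) (incident E l) = restrict (?g b) (incident E l)"
        by (auto simp: restrict_def override_on_def)
      then show "T' l (restrict (?g a) (incident E l)) (x l) = T l (restrict (?g b) (incident E l)) (x l)"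
        using T' l by simp
    qed
    have "e \<in> incident E u" using e by (auto simp: incident_def joins_def)
    then have "restrict (?g a) (incident E u) e = a"
      and "(restrict (?g a) (incident E u))(e := b) = restrict (?g b) (incident E u)" for b
      using e_not_inner by (auto simp: restrict_def override_on_def fun_eq_iff)
    then have "T' u (restrict (?g a) (incident E u)) (x u)
        = (\<Sum>b<m. W a b * T u (restrict (?g b) (incident E u)) (x u))"
      unfolding T'_u by simp
    then show ?thesis
      unfolding split by (simp add: sum_distrib_right mult.assoc rest[symmetric])
  qed
  ultimately show ?thesis
    unfolding half_def pcontract_def by (simp add: sum_distrib_left sum.swap[of _ "{..<m}"])
qed

text \<open>The matrices \<open>W\<close> and \<open>W'\<close> are absorbed into the tensors at the
  two ends of \<open>e\<close>, whose new bond index runs below \<open>m\<close>.\<close>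

lemma contract_transform:
  fixes T :: "nat \<Rightarrow> (edge \<Rightarrow> nat) \<Rightarrow> nat \<Rightarrow> 'k::comm_semiring_1"
  assumes "\<And>x. x \<in> idx d n \<Longrightarrow> contract d n E r T x
    = (\<Sum>a<m. (\<Sum>b<r e. W a b * half E r T e u b x) * (\<Sum>b<r e. W' a b * half E r T e w b x))"
  shows "contract d n E r T \<in> TN d n E (r(e := m))"
proof -
  interpret sw: tree_edge d E e w u by (rule swap)
  define T' where "T' = T(u := \<lambda>\<gamma> y. \<Sum>b<r e. W (\<gamma> e) b * T u (\<gamma>(e := b)) y,
    w := \<lambda>\<gamma> y. \<Sum>b<r e. W' (\<gamma> e) b * T w (\<gamma>(e := b)) y)"
  have T'_u: "T' u = (\<lambda>\<gamma> y. \<Sum>b<r e. W (\<gamma> e) b * T u (\<gamma>(e := b)) y)"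
    by (simp only: T'_def fun_upd_other[OF u_neq_w] fun_upd_same)
  have T'_w: "T' w = (\<lambda>\<gamma> y. \<Sum>b<r e. W' (\<gamma> e) b * T w (\<gamma>(e := b)) y)"
    by (simp only: T'_def fun_upd_same)
  have "contract d n E (r(e := m)) T' x = contract d n E r T x" for x
  proof (cases "x \<in> idx d n")
    case True
    have "half E (r(e := m)) T' e u a x = (\<Sum>b<r e. W a b * half E r T e u b x)" for a
      using not_in_component by (intro half_transform[where T = T and T' = T' and W = W, OF T'_u]) (auto simp: T'_def)
    moreover have "half E (r(e := m)) T' e w a x = (\<Sum>b<r e. W' a b * half E r T e w b x)" for a
      using sw.not_in_component by (intro sw.half_transform[where T = T and T' = T' and W = W', OF T'_w]) (auto simp: T'_def)
    ultimately show ?thesis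
      using contract_split[OF True, of "r(e := m)" T'] assms[OF True] by simp
  qed (simp add: contract_def)
  then show ?thesis unfolding TN_def by (metis ext rangeI)
qed

text \<open>\<open>dependent_reduce\<close> is applied with \<open>Q\<close> the other half at the
  same \<open>x\<close>. Its matrices do not depend on \<open>x\<close>, so they can be built into
  the network.\<close>

lemma dependent_half_reduce:
  fixes T :: "nat \<Rightarrow> (edge \<Rightarrow> nat) \<Rightarrow> nat \<Rightarrow> 'k::field"
  assumes "\<not> indep_on (idx d n) (r e) (half E r T e u)"
  shows "contract d n E r T \<in> TN d n E (r(e := r e - 1))"
proof -
  obtain W W' where "\<forall>x\<in>idx d n. \<forall>Q. (\<Sum>b<r e. half E r T e u b x * Q b)
    = (\<Sum>a<r e - 1. (\<Sum>b<r e. W a b * half E r T e u b x) * (\<Sum>b<r e. W' a b * Q b))"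
    using dependent_reduce[OF assms] by blast
  then show ?thesis
    by (intro contract_transform[where W = W and W' = W']) (auto simp: contract_split)
qed

end

section \<open>Flattenings of local tensors and admissibility\<close>

section \<open>Local tensors\<close>

text \<open>The slices of \<open>T l\<close> along the leg \<open>g\<close>, that is, the rows of
  its flattening at \<open>g\<close>; \<open>local_pts\<close> below indexes the columns.\<close>

definition local_fun :: "edge set \<Rightarrow> (nat \<Rightarrow> (edge \<Rightarrow> nat) \<Rightarrow> nat \<Rightarrow> 'k) \<Rightarrow> nat \<Rightarrow> edge
    \<Rightarrow> nat \<Rightarrow> (edge \<Rightarrow> nat) \<times> nat \<Rightarrow> 'k" where
  "local_fun E T l g b = (\<lambda>(\<gamma>, y). T l (restrict (\<gamma>(g := b)) (incident E l)) y)"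

definition local_pts :: "edge set \<Rightarrow> (nat \<Rightarrow> nat) \<Rightarrow> (edge \<Rightarrow> nat) \<Rightarrow> nat \<Rightarrow> edge
    \<Rightarrow> ((edge \<Rightarrow> nat) \<times> nat) set" where
  "local_pts E n r l g = bond_assign (incident E l - {g}) r \<times> {..<n l}"

context tree
begin

lemma finite_incident [simp]: "finite (incident E l)"
  using finite_E incident_subset finite_subset by blast

lemma finite_local_pts [simp]: "finite (local_pts E n r l g)"
  by (simp add: local_pts_def bond_assign_def finite_PiE)

lemma card_local_pts: "card (local_pts E n r l g) = n l * (\<Prod>f\<in>incident E l - {g}. r f)"
  by (simp add: local_pts_def bond_assign_def card_cartesian_product card_PiE mult.commute)

text \<open>Two opposite directed edges between the same vertices are excluded only by the edge
  count: after deleting one, the other would still connect the ends.\<close>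

lemma joins_unique:
  assumes "e \<in> E" "f \<in> E" "joins e u w" "joins f u w"
  shows "f = e"
proof (rule ccontr)
  assume "f \<noteq> e"
  interpret tree_edge d E e u w using assms by unfold_locales
  show False
    using component_closed[OF assms(2) \<open>f \<noteq> e\<close>] root_component not_in_component assms(4)
    by (auto simp: joins_def)
qed

lemma bond_eq: "e \<in> E \<Longrightarrow> joins e u w \<Longrightarrow> bond E r u w = r e"
  using joins_unique[of e "(u, w)" u w] by (auto simp: bond_def joins_def)

lemma prod_bond_eq:
  assumes e: "e \<in> E" "joins e u w"
  shows "(\<Prod>k\<in>nb E u - {w}. bond E r u k) = (\<Prod>f\<in>incident E u - {e}. r f)"
proof -
  \<comment> \<open>The other end of \<open>f\<close> seen from \<open>u\<close>; it translates
    between incident edges and neighbours.\<close>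
  define h where "h f = (if fst f = u then snd f else fst f)" for f :: edge
  have h: "joins f u (h f)" if "f \<in> incident E u" for f
    using that by (cases f) (auto simp: incident_def h_def joins_def)
  have "bij_betw h (incident E u - {e}) (nb E u - {w})"
  proof (rule bij_betwI')
    fix f f' assume *: "f \<in> incident E u - {e}" "f' \<in> incident E u - {e}"
    then have "joins f u (h f)" "joins f' u (h f')" "f \<in> E" "f' \<in> E"
      using h incident_subset[of E u] by auto
    then show "h f = h f' \<longleftrightarrow> f = f'" using joins_unique by metis
  next
    fix f assume f: "f \<in> incident E u - {e}"
    then have *: "joins f u (h f)" "f \<in> E" using h incident_subset[of E u] by auto
    then have "h f \<noteq> w" using joins_unique[of e f u w] e f by auto
    then show "h f \<in> nb E u - {w}" using * by (auto simp: nb_def joins_def)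
  next
    fix k assume k: "k \<in> nb E u - {w}"
    then obtain f where f: "f \<in> E" "joins f u k" by (auto simp: nb_def joins_def)
    then have "u \<noteq> k" "f \<noteq> e" using joins_neq e k by (auto simp: joins_def)
    then show "\<exists>f\<in>incident E u - {e}. k = h f"
      using f by (intro bexI[of _ f]) (auto simp: h_def joins_def incident_def)
  qed
  then have "(\<Prod>k\<in>nb E u - {w}. bond E r u k) = (\<Prod>f\<in>incident E u - {e}. bond E r u (h f))"
    by (rule prod.reindex_bij_betw[symmetric])
  also have "\<dots> = (\<Prod>f\<in>incident E u - {e}. r f)"
    using h incident_subset[of E u] by (intro prod.cong refl bond_eq) auto
  finally show ?thesis .
qed

text \<open>The bound in admissibility is the number of columns of the local flattening, so it is
  the condition for that flattening to be able to have full row rank.\<close>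

lemma admissible_iff:
  "admissible d n E r \<longleftrightarrow> (\<forall>e u w. e \<in> E \<longrightarrow> joins e u w \<longrightarrow> r e \<le> card (local_pts E n r u e))"
proof -
  have "bond E r u w \<le> n u * (\<Prod>k\<in>nb E u - {w}. bond E r u k)
      \<longleftrightarrow> r e \<le> card (local_pts E n r u e)" if "e \<in> E" "joins e u w" for e u w
    using that by (simp add: bond_eq prod_bond_eq card_local_pts)
  moreover have "w \<in> nb E u \<longleftrightarrow> (\<exists>e\<in>E. joins e u w)" for u w
    by (auto simp: nb_def joins_def)
  moreover have "u < d" if "e \<in> E" "joins e u w" for e u w
    using joins_less[OF that] by simp
  ultimately show ?thesis unfolding admissible_def by blast
qed

text \<open>Choose \<open>r g\<close> distinct columns and let row \<open>b\<close> be the indicator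
  of column \<open>a b\<close>; the sample matrix is then the identity.\<close>

lemma local_full_rank_exists:
  assumes "g \<in> incident E l" "r g \<le> card (local_pts E n r l g)"
  shows "\<exists>(T :: nat \<Rightarrow> (edge \<Rightarrow> nat) \<Rightarrow> nat \<Rightarrow> 'k::field) a. (\<forall>p<r g. a p \<in> local_pts E n r l g)
    \<and> det (sample_mat (r g) (local_fun E T l g) a) \<noteq> 0"
proof -
  obtain a where a: "a ` {..<r g} \<subseteq> local_pts E n r l g" "inj_on a {..<r g}"
    using card_le_inj[of "{..<r g}" "local_pts E n r l g"] assms(2) by auto
  define T :: "nat \<Rightarrow> (edge \<Rightarrow> nat) \<Rightarrow> nat \<Rightarrow> 'k" where
    "T = (\<lambda>_ \<gamma> y. if (restrict \<gamma> (incident E l - {g}), y) = a (\<gamma> g) then 1 else 0)"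
  have "local_fun E T l g b (a p) = (if p = b then 1 else 0)" if "p < r g" "b < r g" for p b
  proof -
    obtain \<gamma> y where ap: "a p = (\<gamma>, y)" by fastforce
    have "(\<gamma>, y) \<in> local_pts E n r l g" using a(1) that ap by (metis image_subset_iff lessThan_iff)
    then have ext: "\<gamma> \<in> extensional (incident E l - {g})"
      by (auto simp: local_pts_def bond_assign_def PiE_def)
    have "restrict (restrict (\<gamma>(g := b)) (incident E l)) (incident E l - {g}) = \<gamma>"
      using ext by (auto simp: fun_eq_iff restrict_def extensional_def)
    then have "local_fun E T l g b (a p) = (if (\<gamma>, y) = a b then 1 else 0)"
      using assms(1) ap by (simp add: local_fun_def T_def)
    also have "\<dots> = (if p = b then 1 else 0)"
      using a(2) that ap by (metis inj_on_eq_iff lessThan_iff)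
    finally show ?thesis .
  qed
  then have "sample_mat (r g) (local_fun E T l g) a = 1\<^sub>m (r g)"
    by (intro eq_matI) (auto simp: sample_mat_def)
  then show ?thesis using a by (intro exI[of _ T] exI[of _ a]) auto
qed

end

section \<open>From local tensors to halves: dependence and independence\<close>

context tree_edge
begin

text \<open>By \<open>half_transform\<close>, combining the halves with coefficients
  \<open>c\<close> amounts to combining the slices of \<open>T u\<close>, and these cancel wherever
  the contraction evaluates them.\<close>

lemma local_dependent:
  fixes T :: "nat \<Rightarrow> (edge \<Rightarrow> nat) \<Rightarrow> nat \<Rightarrow> 'k::comm_ring_1"
  assumes "\<not> indep_on (local_pts E n r u e) (r e) (local_fun E T u e)"
  shows "\<not> indep_on (idx d n) (r e) (half E r T e u)"
proof -
  obtain c b0 where c: "\<And>z. z \<in> local_pts E n r u e \<Longrightarrow> (\<Sum>b<r e. c b * local_fun E T u e b z) = 0"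
    and b0: "b0 < r e" "c b0 \<noteq> 0"
    using assms unfolding indep_on_def by blast
  let ?C = "component E e u" and ?F = "inner_edges E (component E e u)"
  define T' where "T' = T(u := \<lambda>\<gamma> y. \<Sum>b<r e. c b * T u (\<gamma>(e := b)) y)"
  have T'_u: "T' u = (\<lambda>\<gamma> y. \<Sum>b<r e. c b * T u (\<gamma>(e := b)) y)"
    by (simp only: T'_def fun_upd_same)
  have "(\<Sum>b<r e. c b * half E r T e u b x) = 0" if x: "x \<in> idx d n" for x
  proof -
    \<comment> \<open>\<open>T' u\<close> sums out the index of \<open>e\<close>, so the value 0 put
      there is arbitrary.\<close>
    have "T' u (restrict (override_on ((\<lambda>_. 0)(e := 0)) \<beta> ?F) (incident E u)) (x u) = 0"
      if \<beta>: "\<beta> \<in> bond_assign ?F r" for \<beta>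
    proof -
      let ?g = "override_on ((\<lambda>_. 0)(e := 0)) \<beta> ?F"
      \<comment> \<open>Hence \<open>\<beta>\<close> supplies an index in range on every leg of
        \<open>u\<close> except \<open>e\<close>.\<close>
      have inc: "incident E u - {e} \<subseteq> ?F" using incident_component[OF root_component] by blast
      have "restrict ?g (incident E u - {e}) \<in> bond_assign (incident E u - {e}) r"
        using \<beta> inc unfolding bond_assign_def override_on_def by (auto simp: PiE_iff)
      moreover have "x u < n u" using x u_less by (auto simp: idx_def PiE_iff)
      ultimately have "(restrict ?g (incident E u - {e}), x u) \<in> local_pts E n r u e"
        by (simp add: local_pts_def)
      then have "(\<Sum>b<r e. c b * T u (restrict ((restrict ?g (incident E u - {e}))(e := b)) (incident E u)) (x u)) = 0"
        using c unfolding local_fun_def by fastforce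
      moreover have "restrict ((restrict ?g (incident E u - {e}))(e := b)) (incident E u)
          = (restrict ?g (incident E u))(e := b)" for b
        using e by (auto simp: fun_eq_iff restrict_def incident_def joins_def)
      ultimately show ?thesis unfolding T'_u by simp
    qed
    then have "half E r T' e u 0 x = 0"
      unfolding half_def pcontract_def using root_component
      by (intro sum.neutral ballI prod_zero) auto
    moreover have "half E r T' e u 0 x = (\<Sum>b<r e. c b * half E r T e u b x)"
      by (intro half_transform[where T = T and T' = T' and W = "\<lambda>_. c", OF T'_u]) (auto simp: T'_def)
    ultimately show ?thesis by simp
  qed
  then show ?thesis using b0 unfolding indep_on_def by blast
qed

text \<open>A relation on a grown set, assumed for all values of its open legs, is pushed back to
  the set before the last vertex was attached, and finally to \<open>u\<close>, where local
  independence at \<open>e\<close> applies. The coefficients \<open>c\<close> never change.\<close>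

lemma grown_indep:
  fixes T :: "nat \<Rightarrow> (edge \<Rightarrow> nat) \<Rightarrow> nat \<Rightarrow> 'k::comm_ring_1"
  assumes loc: "\<And>l g. l < d \<Longrightarrow> g \<in> incident E l \<Longrightarrow> indep_on (local_pts E n r l g) (r g) (local_fun E T l g)"
    and r: "\<forall>f\<in>E. 1 \<le> r f" and n: "\<forall>l<d. 1 \<le> n l"
    and S: "grown (E - {e}) u S"
    and c: "\<And>\<gamma> x. \<forall>f\<in>E. \<gamma> f < r f \<Longrightarrow> x \<in> idx d n
      \<Longrightarrow> (\<Sum>a<r e. c a * pcontract E r T (inner_edges E S) S (\<gamma>(e := a)) x) = 0"
  shows "\<forall>a<r e. c a = 0"
  using S c
proof (induction rule: grown.induct)
  case base
  have no_inner: "inner_edges E {u} = {}"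
    using no_loop by (force simp: inner_edges_def)
  have e_u: "e \<in> incident E u" using e by (auto simp: incident_def joins_def)
  have "\<forall>z\<in>local_pts E n r u e. (\<Sum>a<r e. c a * local_fun E T u e a z) = 0"
  proof
    fix z assume "z \<in> local_pts E n r u e"
    then obtain \<gamma> y where z: "z = (\<gamma>, y)" and \<gamma>: "\<gamma> \<in> bond_assign (incident E u - {e}) r" and y: "y < n u"
      by (auto simp: local_pts_def)
    \<comment> \<open>The value 0 elsewhere is in range because all bonds are at least 1; the entry
      at \<open>e\<close> gets overwritten. The index \<open>x\<close> below is filled up with 0
      likewise.\<close>
    define \<delta> where "\<delta> g = (if g \<in> incident E u - {e} then \<gamma> g else 0)" for g
    define x where "x = (restrict (\<lambda>_. 0) {0..<d})(u := y)"
    have "\<forall>f\<in>E. \<delta> f < r f" using \<gamma> r by (fastforce simp: \<delta>_def bond_assign_def PiE_iff)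
    moreover have "x \<in> idx d n" using y n u_less by (fastforce simp: x_def idx_def PiE_iff extensional_def)
    ultimately have "(\<Sum>a<r e. c a * pcontract E r T {} {u} (\<delta>(e := a)) x) = 0"
      using base unfolding no_inner by blast
    moreover have "restrict (\<delta>(e := a)) (incident E u) = restrict (\<gamma>(e := a)) (incident E u)" for a
      by (auto simp: fun_eq_iff restrict_def \<delta>_def)
    ultimately show "(\<Sum>a<r e. c a * local_fun E T u e a z) = 0"
      by (simp add: pcontract_no_edges local_fun_def z x_def)
  qed
  then show ?case using loc[OF u_less e_u] unfolding indep_on_def by blast
next
  case (step S f l k)
  have gE: "grown E u S" using step.hyps(1) by (rule grown_mono) auto
  have f: "f \<in> E" "f \<noteq> e" "joins f l k" "l \<in> S" "k \<notin> S" using step.hyps by auto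
  have inner: "inner_edges E (insert k S) = insert f (inner_edges E S)"
    using inner_edges_insert[OF gE u_less] f by blast
  have f_new: "f \<notin> inner_edges E S" using f by (auto simp: inner_edges_def joins_def)
  have "insert k S \<subseteq> component E e u"
    using grown_subset_reach[OF grown.step[OF step.hyps]] by (simp add: component_def)
  then have k: "k < d" "k \<noteq> u" "e \<notin> incident E k"
    using component_subset e_incident_component[of k] grown_root[OF gE] f by auto
  have f_k: "f \<in> incident E k" using f by (auto simp: incident_def joins_def)
  show ?case
  proof (rule step.IH)
    fix \<gamma> x assume \<gamma>: "\<forall>f\<in>E. \<gamma> f < r f" and x: "x \<in> idx d n"
    \<comment> \<open>The relation on \<open>S\<close> with the index of the attaching edge
      \<open>f\<close> fixed to \<open>b\<close>. These values are the coefficients of a relation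
      among the slices of \<open>T k\<close> along \<open>f\<close>.\<close>
    define D where "D b = (\<Sum>a<r e. c a * pcontract E r T (inner_edges E S) S (\<gamma>(e := a, f := b)) x)" for b
    have "\<forall>z\<in>local_pts E n r k f. (\<Sum>b<r f. D b * local_fun E T k f b z) = 0"
    proof
      fix z assume "z \<in> local_pts E n r k f"
      then obtain \<gamma>' y where z: "z = (\<gamma>', y)" and \<gamma>': "\<gamma>' \<in> bond_assign (incident E k - {f}) r" and y: "y < n k"
        by (auto simp: local_pts_def)
      \<comment> \<open>Only the legs of \<open>k\<close> other than \<open>f\<close> are changed,
        and then the physical index at \<open>k\<close>. By \<open>incident_disjoint\<close> no
        vertex of \<open>S\<close> sees these legs, so the factor of \<open>S\<close> is
        unaffected.\<close>
      define \<delta> where "\<delta> g = (if g \<in> incident E k - {f} then \<gamma>' g else \<gamma> g)" for g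
      define x' where "x' = x(k := y)"
      have \<delta>: "\<forall>f\<in>E. \<delta> f < r f" using \<gamma> \<gamma>' by (auto simp: \<delta>_def bond_assign_def PiE_iff)
      have x': "x' \<in> idx d n" using x y k by (auto simp: x'_def idx_def PiE_iff extensional_def)
      have *: "pcontract E r T (inner_edges E S) (insert k S) (\<delta>(e := a, f := b)) x'
          = pcontract E r T (inner_edges E S) S (\<gamma>(e := a, f := b)) x * local_fun E T k f b z" for a b
      proof -
        have "pcontract E r T (inner_edges E S) ({k} \<union> S) (\<delta>(e := a, f := b)) x'
          = pcontract E r T {} {k} (\<delta>(e := a, f := b)) x'
            * pcontract E r T (inner_edges E S) S (\<delta>(e := a, f := b)) x'"
          using f grown_finite[OF gE] incident_inner_edges[of k S E]
          by (intro pcontract_union_vertices) auto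
        moreover have "restrict (\<delta>(e := a, f := b)) (incident E k) = restrict (\<gamma>'(f := b)) (incident E k)"
          using k by (auto simp: fun_eq_iff restrict_def \<delta>_def)
        moreover have "pcontract E r T (inner_edges E S) S (\<delta>(e := a, f := b)) x'
            = pcontract E r T (inner_edges E S) S (\<gamma>(e := a, f := b)) x"
        proof (rule pcontract_cong)
          fix m g assume "m \<in> S" "g \<in> incident E m"
          then have "g \<notin> incident E k - {f}"
            using incident_disjoint[OF gE u_less f(1,3,4,5)] by auto
          then show "(\<delta>(e := a, f := b)) g = (\<gamma>(e := a, f := b)) g" by (auto simp: \<delta>_def)
        qed (use f in \<open>auto simp: x'_def\<close>)
        ultimately show ?thesis
          by (simp add: pcontract_no_edges local_fun_def z x'_def mult.commute)
      qed
      have "(\<Sum>b<r f. D b * local_fun E T k f b z)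
          = (\<Sum>b<r f. \<Sum>a<r e. c a * pcontract E r T (inner_edges E S) (insert k S) (\<delta>(e := a, f := b)) x')"
        unfolding * by (simp add: D_def sum_distrib_right mult.assoc)
      also have "\<dots> = (\<Sum>a<r e. \<Sum>b<r f. c a * pcontract E r T (inner_edges E S) (insert k S) (\<delta>(e := a, f := b)) x')"
        by (rule sum.swap)
      also have "\<dots> = (\<Sum>a<r e. c a * pcontract E r T (inner_edges E (insert k S)) (insert k S) (\<delta>(e := a)) x')"
        using f_new by (simp add: inner pcontract_insert_edge sum_distrib_left)
      also have "\<dots> = 0" using step.prems \<delta> x' by blast
      finally show "(\<Sum>b<r f. D b * local_fun E T k f b z) = 0" .
    qed
    then have "D b = 0" if "b < r f" for b
      using that loc[OF k(1) f_k] unfolding indep_on_def by blast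
    \<comment> \<open>Specializing \<open>b\<close> to the value that \<open>\<gamma>\<close>
      already has at \<open>f\<close> recovers the relation on \<open>S\<close>.\<close>
    then have "D (\<gamma> f) = 0" using \<gamma> f by blast
    moreover have "\<gamma>(e := a, f := \<gamma> f) = \<gamma>(e := a)" for a using f by auto
    ultimately show "(\<Sum>a<r e. c a * pcontract E r T (inner_edges E S) S (\<gamma>(e := a)) x) = 0"
      by (simp add: D_def)
  qed
qed

lemma half_indep:
  fixes T :: "nat \<Rightarrow> (edge \<Rightarrow> nat) \<Rightarrow> nat \<Rightarrow> 'k::comm_ring_1"
  assumes "\<And>l g. l < d \<Longrightarrow> g \<in> incident E l \<Longrightarrow> indep_on (local_pts E n r l g) (r g) (local_fun E T l g)"
    and "\<forall>f\<in>E. 1 \<le> r f" "\<forall>l<d. 1 \<le> n l"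
  shows "indep_on (idx d n) (r e) (half E r T e u)"
  unfolding indep_on_def
proof (intro allI impI)
  fix c b assume c: "\<forall>x\<in>idx d n. (\<Sum>b<r e. c b * half E r T e u b x) = 0" and b: "b < r e"
  have "\<forall>b<r e. c b = 0"
  proof (rule grown_indep[OF assms grown_component])
    fix \<gamma> x assume "x \<in> idx d n"
    then show "(\<Sum>b<r e. c b * pcontract E r T (inner_edges E (component E e u)) (component E e u) (\<gamma>(e := b)) x) = 0"
      using c unfolding half_eq_pcontract[where \<gamma> = \<gamma>] by blast
  qed
  then show "c b = 0" using b by blast
qed

end

section \<open>Minors of flattenings and their polynomial dependence on the local tensors\<close>

section \<open>Flattening ranks\<close>

text \<open>Lets rows and columns of the flattening at \<open>e\<close> be named by full
  multi-indices, of which only one side is read.\<close>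

definition merge :: "edge set \<Rightarrow> edge \<Rightarrow> (nat \<Rightarrow> nat) \<Rightarrow> (nat \<Rightarrow> nat) \<Rightarrow> nat \<Rightarrow> nat" where
  "merge E e x y = (\<lambda>l. if l \<in> component E e (fst e) then x l else y l)"

definition edge_minor :: "edge set \<Rightarrow> edge \<Rightarrow> nat \<Rightarrow> (nat \<Rightarrow> nat \<Rightarrow> nat) \<Rightarrow> (nat \<Rightarrow> nat \<Rightarrow> nat)
    \<Rightarrow> ((nat \<Rightarrow> nat) \<Rightarrow> 'k::comm_ring_1) \<Rightarrow> 'k" where
  "edge_minor E e m a b v = det (mat m m (\<lambda>(p, q). v (merge E e (a p) (b q))))"

text \<open>Packs all local entries into one point of a coordinate space, so that polynomial
  arguments apply to the parameters of the network.\<close>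

definition tensors_of :: "(nat \<times> (edge \<Rightarrow> nat) \<times> nat \<Rightarrow> 'k) \<Rightarrow> nat \<Rightarrow> (edge \<Rightarrow> nat) \<Rightarrow> nat \<Rightarrow> 'k" where
  "tensors_of \<tau> = (\<lambda>l \<gamma> y. \<tau> (l, \<gamma>, y))"

lemma tensors_of_surj: "\<exists>\<tau>. tensors_of \<tau> = T"
  by (rule exI[of _ "\<lambda>(l, \<gamma>, y). T l \<gamma> y"]) (simp add: tensors_of_def)

lemma merge_idx: "x \<in> idx d n \<Longrightarrow> y \<in> idx d n \<Longrightarrow> merge E e x y \<in> idx d n"
  by (auto simp: merge_def idx_def PiE_iff extensional_def)

lemma edge_minor_polyfun:
  assumes "\<forall>p<m. a p \<in> idx d n" "\<forall>p<m. b p \<in> idx d n"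
  shows "edge_minor E e m a b \<in> polyfun (idx d n)"
  unfolding edge_minor_def
  using assms by (intro polyfun_det polyfun.coord merge_idx) auto

lemma contract_in_tensor_space: "contract d n E r T \<in> tensor_space (idx d n)"
  by (simp add: tensor_space_def contract_def)

context tree
begin

lemma tree_edge_ends: "e \<in> E \<Longrightarrow> tree_edge d E e (fst e) (snd e)"
  by unfold_locales (auto simp: joins_def)

lemma contract_polyfun:
  "(\<lambda>\<tau>. contract d n E r (tensors_of \<tau> :: _ \<Rightarrow> _ \<Rightarrow> _ \<Rightarrow> 'k::comm_ring_1) x) \<in> polyfun UNIV"
proof (cases "x \<in> idx d n")
  case True
  have "finite (bond_assign E r)" by (simp add: bond_assign_def finite_PiE)
  then show ?thesis
    using True by (auto simp: contract_def tensors_of_def intro!: polyfun_sum polyfun_prod polyfun.coord)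
qed (simp add: contract_def polyfun.const)

lemma local_det_polyfun:
  "(\<lambda>\<tau>. det (sample_mat m (local_fun E (tensors_of \<tau> :: _ \<Rightarrow> _ \<Rightarrow> _ \<Rightarrow> 'k::comm_ring_1) l g) a)) \<in> polyfun UNIV"
  unfolding sample_mat_def local_fun_def tensors_of_def case_prod_unfold
  using polyfun_det[where C = UNIV and m = m and
    M = "\<lambda>p b \<tau>. \<tau> (l, restrict ((fst (a p))(g := b)) (incident E l), snd (a p))"]
  by (simp add: polyfun.coord case_prod_unfold)

lemma edge_minor_contract:
  fixes T :: "nat \<Rightarrow> (edge \<Rightarrow> nat) \<Rightarrow> nat \<Rightarrow> 'k::comm_ring_1"
  assumes "e \<in> E" "\<forall>p<m. a p \<in> idx d n" "\<forall>p<m. b p \<in> idx d n"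
  shows "edge_minor E e m a b (contract d n E r T)
    = det (mat m m (\<lambda>(p, q). \<Sum>c<r e. half E r T e (fst e) c (a p) * half E r T e (snd e) c (b q)))"
proof -
  interpret tree_edge d E e "fst e" "snd e" using assms(1) by (rule tree_edge_ends)
  have "contract d n E r T (merge E e x y)
      = (\<Sum>c<r e. half E r T e (fst e) c x * half E r T e (snd e) c y)"
    if "x \<in> idx d n" "y \<in> idx d n" for x y
  proof -
    have "half E r T e (fst e) c (merge E e x y) = half E r T e (fst e) c x" for c
      by (rule half_cong) (simp add: merge_def)
    moreover have "half E r T e (snd e) c (merge E e x y) = half E r T e (snd e) c y" for c
      using component_disjoint by (intro half_cong) (auto simp: merge_def)
    ultimately show ?thesis
      using merge_idx[OF that] by (simp add: contract_split)
  qed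
  then show ?thesis
    unfolding edge_minor_def using assms(2,3)
    by (intro arg_cong[of _ _ det] eq_matI) auto
qed

lemma edge_minor_eq_0:
  assumes "e \<in> E" "\<forall>p<m. a p \<in> idx d n" "\<forall>p<m. b p \<in> idx d n" "r e < m"
  shows "edge_minor E e m a b (contract d n E r T :: _ \<Rightarrow> 'k::comm_ring_1) = 0"
  unfolding edge_minor_contract[OF assms(1-3)]
  by (rule det_factor_small[where P = "\<lambda>c p. half E r T e (fst e) c (a p)"
        and Q = "\<lambda>c q. half E r T e (snd e) c (b q)", OF assms(4)])

text \<open>Rank at least \<open>m\<close> of the flattening at \<open>e\<close>; on
  \<open>TN d n E r\<close> with \<open>m = r e\<close> the rank is then exactly
  \<open>m\<close>.\<close>

definition full_edge_rank :: "(nat \<Rightarrow> nat) \<Rightarrow> edge \<Rightarrow> nat \<Rightarrow> ((nat \<Rightarrow> nat) \<Rightarrow> 'k::comm_ring_1) \<Rightarrow> bool" where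
  "full_edge_rank n e m v \<longleftrightarrow> (\<exists>a b. (\<forall>p<m. a p \<in> idx d n) \<and> (\<forall>p<m. b p \<in> idx d n) \<and> edge_minor E e m a b v \<noteq> 0)"

lemma indep_imp_full_edge_rank:
  fixes T :: "nat \<Rightarrow> (edge \<Rightarrow> nat) \<Rightarrow> nat \<Rightarrow> 'k::field"
  assumes "e \<in> E" "indep_on (idx d n) (r e) (half E r T e (fst e))"
    "indep_on (idx d n) (r e) (half E r T e (snd e))"
  shows "full_edge_rank n e (r e) (contract d n E r T)"
proof -
  obtain a b where "\<forall>p<r e. a p \<in> idx d n" "det (sample_mat (r e) (half E r T e (fst e)) a) \<noteq> 0"
    and "\<forall>p<r e. b p \<in> idx d n" "det (sample_mat (r e) (half E r T e (snd e)) b) \<noteq> 0"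
    using indep_on_imp_det_nonzero[OF assms(2)] indep_on_imp_det_nonzero[OF assms(3)] by blast
  then show ?thesis
    unfolding full_edge_rank_def
    by (intro exI[of _ a] exI[of _ b]) (simp add: edge_minor_contract[OF assms(1)] det_factor)
qed

text \<open>If the rank is too small, one of the two halves is dependent, and the reduction is
  carried out from that side.\<close>

lemma dependent_imp_reduce:
  fixes T :: "nat \<Rightarrow> (edge \<Rightarrow> nat) \<Rightarrow> nat \<Rightarrow> 'k::field"
  assumes "e \<in> E" "\<not> full_edge_rank n e (r e) (contract d n E r T)"
  shows "contract d n E r T \<in> TN d n E (r(e := r e - 1))"
  using indep_imp_full_edge_rank[of e n r T] assms tree_edge_ends[OF assms(1)]
    tree_edge.dependent_half_reduce tree_edge.swap by metis

lemma zero_in_TN: "(\<lambda>_. 0 :: 'k::comm_semiring_1) \<in> TN d n E r"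
proof -
  have "contract d n E r (\<lambda>_ _ _. 0) = (\<lambda>_. 0 :: 'k)"
    using d_pos by (auto simp: contract_def fun_eq_iff zero_power)
  then show ?thesis unfolding TN_def by (metis rangeI)
qed

lemma TN_zero_bond:
  assumes "e \<in> E" "r e = 0" "v \<in> TN d n E r"
  shows "v = (\<lambda>_. 0 :: 'k::comm_semiring_1)"
proof -
  obtain T where v: "v = contract d n E r T" using assms(3) unfolding TN_def by blast
  show ?thesis
  proof
    fix x
    show "v x = 0"
      using tree_edge.contract_split[OF tree_edge_ends[OF assms(1)], of x n r T] assms(2)
      by (cases "x \<in> idx d n") (auto simp: v contract_def)
  qed
qed

text \<open>\<open>2 \<le> r e\<close> keeps the lowered bond positive, as the competitors in
  \<open>TNo\<close> must be.\<close>

lemma not_in_TNo: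
  assumes "\<forall>f\<in>E. 1 \<le> r f" "e \<in> E" "2 \<le> r e" "v \<in> TN d n E (r(e := r e - 1))"
  shows "v \<notin> TNo d n E r"
proof -
  have "r(e := r e - 1) \<in> {s. (\<forall>e\<in>E. 1 \<le> s e \<and> s e \<le> r e) \<and> (\<exists>e\<in>E. s e \<noteq> r e)}"
    using assms(1-3) by (auto intro!: bexI[of _ e])
  then show ?thesis using assms(4) unfolding TNo_def by blast
qed

text \<open>A rank defect at \<open>e\<close> allows \<open>r e\<close> to be lowered, while a
  smaller bond at \<open>e\<close> forces a rank defect there. The edge \<open>e0\<close> excludes
  networks with all bonds 1, where the zero tensor lies in \<open>TNo\<close>.\<close>

lemma TNo_iff_full_edge_rank:
  fixes v :: "(nat \<Rightarrow> nat) \<Rightarrow> 'k::field"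
  assumes r: "\<forall>f\<in>E. 1 \<le> r f" and e0: "e0 \<in> E" "2 \<le> r e0" and v: "v \<in> TN d n E r"
  shows "v \<in> TNo d n E r \<longleftrightarrow> (\<forall>e\<in>E. full_edge_rank n e (r e) v)"
proof
  assume vo: "v \<in> TNo d n E r"
  obtain T where T: "v = contract d n E r T" using v unfolding TN_def by blast
  show "\<forall>e\<in>E. full_edge_rank n e (r e) v"
  proof (rule ballI, rule ccontr)
    fix e assume e: "e \<in> E" and "\<not> full_edge_rank n e (r e) v"
    then have red: "v \<in> TN d n E (r(e := r e - 1))"
      using dependent_imp_reduce unfolding T by blast
    \<comment> \<open>A bond of dimension 1 cannot be lowered in the definition of \<open>TNo\<close>, but then \<open>v = 0\<close>, and \<open>e0\<close> can be lowered.\<close>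
    have "v \<in> TN d n E (r(e0 := r e0 - 1))" if "r e = 1"
      using TN_zero_bond[OF e _ red] zero_in_TN that by auto
    then show False
    proof (cases "r e = 1")
      case False
      then have "2 \<le> r e" using r e by (metis One_nat_def Suc_1 le_antisym not_less_eq_eq)
      then show False using not_in_TNo[OF r e _ red] vo by blast
    qed (use not_in_TNo[OF r e0] vo in blast)
  qed
next
  assume full: "\<forall>e\<in>E. full_edge_rank n e (r e) v"
  have False if s: "\<forall>e\<in>E. 1 \<le> s e \<and> s e \<le> r e" "e \<in> E" "s e \<noteq> r e" "v \<in> TN d n E s" for s e
  proof -
    obtain T where T: "v = contract d n E s T" using s(4) unfolding TN_def by blast
    have "s e < r e" using s by (simp add: nat_less_le)
    moreover obtain a b where "\<forall>p<r e. a p \<in> idx d n" "\<forall>p<r e. b p \<in> idx d n" "edge_minor E e (r e) a b v \<noteq> 0"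
      using full s(2) unfolding full_edge_rank_def by blast
    ultimately show False using edge_minor_eq_0[OF s(2)] unfolding T by blast
  qed
  then show "v \<in> TNo d n E r" using v unfolding TNo_def by blast
qed

section \<open>Emptiness, generic full rank, openness and density\<close>

text \<open>Where admissibility fails, the local flattening has more rows than columns. Its rows are
  dependent for every choice of tensors, hence so is the half, and the bond can always be
  lowered.\<close>

lemma TNo_empty:
  assumes r: "\<forall>f\<in>E. 1 \<le> r f" and n: "\<forall>l<d. 1 \<le> n l" and "\<not> admissible d n E r"
  shows "TNo d n E r = ({} :: ((nat \<Rightarrow> nat) \<Rightarrow> 'k::field) set)"
proof -
  obtain e u w where e: "e \<in> E" "joins e u w" and small: "card (local_pts E n r u e) < r e"
    using assms(3) unfolding admissible_iff by (meson not_le)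
  interpret tree_edge d E e u w using e by unfold_locales
  \<comment> \<open>The violated bound is at least 1, so the offending bond is at least 2 and can be
    lowered within the range considered by \<open>TNo\<close>.\<close>
  have "0 < (\<Prod>f\<in>incident E u - {e}. r f)"
    using r incident_subset[of E u] by (intro prod_pos) fastforce
  moreover have "0 < n u" using n u_less by fastforce
  ultimately have "0 < n u * (\<Prod>f\<in>incident E u - {e}. r f)" by simp
  then have re: "2 \<le> r e" using small unfolding card_local_pts by linarith
  have "v \<notin> TNo d n E r" for v :: "(nat \<Rightarrow> nat) \<Rightarrow> 'k"
  proof
    assume v: "v \<in> TNo d n E r"
    then obtain T where T: "v = contract d n E r T" unfolding TNo_def TN_def by blast
    have "\<not> indep_on (local_pts E n r u e) (r e) (local_fun E T u e)"
      using small indep_on_le_card[of "local_pts E n r u e" "r e" "local_fun E T u e"] by auto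
    then have "v \<in> TN d n E (r(e := r e - 1))"
      unfolding T by (intro dependent_half_reduce local_dependent)
    then show False using not_in_TNo[OF r e(1) re] v by blast
  qed
  then show ?thesis by blast
qed

text \<open>Each pair of a vertex and a leg gives one determinant that is not identically zero. A
  common nonvanishing point of these finitely many polynomials makes all local flattenings full rank
  at once, and \<open>half_indep\<close> does the rest.\<close>

lemma full_rank_tensor_exists:
  assumes inf: "infinite (UNIV :: 'k::field set)"
    and r: "\<forall>f\<in>E. 1 \<le> r f" and n: "\<forall>l<d. 1 \<le> n l" and adm: "admissible d n E r"
  shows "\<exists>T :: nat \<Rightarrow> (edge \<Rightarrow> nat) \<Rightarrow> nat \<Rightarrow> 'k. \<forall>e\<in>E. full_edge_rank n e (r e) (contract d n E r T)"
proof -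
  let ?K = "Sigma {..<d} (incident E)"
  have "\<exists>(T :: nat \<Rightarrow> (edge \<Rightarrow> nat) \<Rightarrow> nat \<Rightarrow> 'k) a. (\<forall>p<r g. a p \<in> local_pts E n r l g)
      \<and> det (sample_mat (r g) (local_fun E T l g) a) \<noteq> 0" if "(l, g) \<in> ?K" for l g
  proof (rule local_full_rank_exists)
    show "g \<in> incident E l" using that by simp
    then have "g \<in> E" "joins g l (if fst g = l then snd g else fst g)"
      by (cases g; auto simp: incident_def joins_def)+
    then show "r g \<le> card (local_pts E n r l g)" using adm unfolding admissible_iff by blast
  qed
  \<comment> \<open>Each \<open>T0 l g\<close> serves its own pair only, as witness that the
    corresponding determinant is a nonzero polynomial.\<close>
  then obtain T0 :: "nat \<Rightarrow> edge \<Rightarrow> nat \<Rightarrow> (edge \<Rightarrow> nat) \<Rightarrow> nat \<Rightarrow> 'k" and a where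
    a: "\<And>l g. (l, g) \<in> ?K \<Longrightarrow> \<forall>p<r g. a l g p \<in> local_pts E n r l g"
    and T0: "\<And>l g. (l, g) \<in> ?K \<Longrightarrow> det (sample_mat (r g) (local_fun E (T0 l g) l g) (a l g)) \<noteq> 0"
    by metis
  have "\<exists>\<tau> :: nat \<times> (edge \<Rightarrow> nat) \<times> nat \<Rightarrow> 'k. \<forall>k\<in>?K.
      det (sample_mat (r (snd k)) (local_fun E (tensors_of \<tau>) (fst k) (snd k)) (a (fst k) (snd k))) \<noteq> 0"
  proof (rule polyfun_common_nonzero[OF inf])
    fix k assume "k \<in> ?K"
    then have k: "(fst k, snd k) \<in> ?K" by simp
    obtain \<tau> where "tensors_of \<tau> = T0 (fst k) (snd k)" using tensors_of_surj by blast
    then show "\<exists>\<tau> :: _ \<Rightarrow> 'k. det (sample_mat (r (snd k)) (local_fun E (tensors_of \<tau>) (fst k) (snd k)) (a (fst k) (snd k))) \<noteq> 0"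
      using T0[OF k] by (intro exI[of _ \<tau>]) simp
  qed (auto intro: local_det_polyfun)
  then obtain \<tau> :: "nat \<times> (edge \<Rightarrow> nat) \<times> nat \<Rightarrow> 'k" where
    \<tau>: "\<And>l g. (l, g) \<in> ?K \<Longrightarrow> det (sample_mat (r g) (local_fun E (tensors_of \<tau>) l g) (a l g)) \<noteq> 0"
    by fastforce
  have loc: "indep_on (local_pts E n r l g) (r g) (local_fun E (tensors_of \<tau>) l g)"
    if "l < d" "g \<in> incident E l" for l g
    using det_nonzero_imp_indep_on[OF a \<tau>, of l g] that by auto
  have "full_edge_rank n e (r e) (contract d n E r (tensors_of \<tau>))" if "e \<in> E" for e
    using tree_edge.half_indep[OF _ loc r n] tree_edge_ends[OF that] tree_edge.swap that
    by (metis indep_imp_full_edge_rank)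
  then show ?thesis by blast
qed

text \<open>Openness: \<open>U\<close> is where some product of minors, one minor for each edge,
  does not vanish. Density: such a product and a polynomial nonzero somewhere on \<open>TN\<close>
  are both pulled back to the local tensors, where they have a common nonvanishing point.\<close>

lemma full_edge_rank_open_dense:
  fixes n :: "nat \<Rightarrow> nat" and r :: "edge \<Rightarrow> nat"
  defines "U \<equiv> {v \<in> TN d n E r. \<forall>e\<in>E. full_edge_rank n e (r e) (v :: (nat \<Rightarrow> nat) \<Rightarrow> 'k::field)}"
  assumes inf: "infinite (UNIV :: 'k set)" and ne: "U \<noteq> {}"
  shows "zariski_openin (idx d n) (TN d n E r) U" "zariski_dense_in (idx d n) (TN d n E r) U"
proof -
  let ?pts = "\<lambda>a. \<forall>e\<in>E. \<forall>p<r e. a e p \<in> idx d n"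
  \<comment> \<open>The product turns nonvanishing at all edges into nonvanishing of a single
    polynomial; \<open>a\<close> and \<open>b\<close> take the edge as an argument so that the
    points can be chosen edge by edge.\<close>
  define q :: "_ \<Rightarrow> _ \<Rightarrow> ((nat \<Rightarrow> nat) \<Rightarrow> 'k) \<Rightarrow> 'k" where
    "q a b v = (\<Prod>e\<in>E. edge_minor E e (r e) (a e) (b e) v)" for a b v
  have q: "q a b \<in> polyfun (idx d n)" if "?pts a" "?pts b" for a b
    unfolding q_def using that by (intro polyfun_prod finite_E edge_minor_polyfun) auto
  have U: "v \<in> U \<longleftrightarrow> v \<in> TN d n E r \<and> (\<exists>a b. ?pts a \<and> ?pts b \<and> q a b v \<noteq> 0)" for v
  proof -
    have q_iff: "q a b v \<noteq> 0 \<longleftrightarrow> (\<forall>e\<in>E. edge_minor E e (r e) (a e) (b e) v \<noteq> 0)" for a b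
      by (auto simp: q_def)
    have "(\<forall>e\<in>E. full_edge_rank n e (r e) v) \<longleftrightarrow> (\<exists>a b. ?pts a \<and> ?pts b \<and> q a b v \<noteq> 0)"
      unfolding q_iff full_edge_rank_def bchoice_iff by blast
    then show ?thesis by (simp add: U_def)
  qed
  have sub: "U \<subseteq> TN d n E r" by (auto simp: U_def)
  show "zariski_openin (idx d n) (TN d n E r) U"
    unfolding zariski_openin_def
  proof (intro conjI exI)
    let ?P = "{q a b | a b. ?pts a \<and> ?pts b}"
    show "?P \<subseteq> polyfun (idx d n)" using q by auto
    have "TN d n E r \<subseteq> tensor_space (idx d n)"
      using contract_in_tensor_space by (auto simp: TN_def)
    then have "v \<in> U \<longleftrightarrow> v \<in> TN d n E r - zero_set (idx d n) ?P" for v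
      unfolding U zero_set_def by blast
    then show "U = TN d n E r - zero_set (idx d n) ?P" by blast
  qed (rule sub)
  obtain v0 where "v0 \<in> U" using ne by blast
  then obtain a b T0 where ab: "?pts a" "?pts b" and T0: "q a b (contract d n E r T0) \<noteq> 0"
    using U by (auto simp: TN_def)
  show "zariski_dense_in (idx d n) (TN d n E r) U"
    unfolding zariski_dense_in_def
  proof (intro conjI ballI impI sub, rule ccontr)
    fix p v
    assume p: "p \<in> polyfun (idx d n)" "\<forall>v\<in>U. p v = 0" and "v \<in> TN d n E r" "p v \<noteq> 0"
    then obtain T where T: "p (contract d n E r T) \<noteq> 0" by (auto simp: TN_def)
    obtain \<tau> \<tau>0 where "tensors_of \<tau> = T" "tensors_of \<tau>0 = T0" using tensors_of_surj by metis
    then have "\<exists>z. p (contract d n E r (tensors_of z)) \<noteq> 0 \<and> q a b (contract d n E r (tensors_of z)) \<noteq> 0"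
      using T T0 polyfun_compose[OF p(1) contract_polyfun] polyfun_compose[OF q[OF ab] contract_polyfun]
      by (intro polyfun_common_nonzero2[OF inf, where u = \<tau> and w = \<tau>0]) auto
    then obtain z where z: "p (contract d n E r (tensors_of z)) \<noteq> 0" "q a b (contract d n E r (tensors_of z)) \<noteq> 0"
      by blast
    then have "contract d n E r (tensors_of z) \<in> U" using U ab by (auto simp: TN_def)
    then show False using p(2) z(1) by blast
  qed
qed

end

theorem mainTheorem5:
  fixes d :: nat and n :: "nat \<Rightarrow> nat" and E :: "edge set" and r :: "edge \<Rightarrow> nat"
  assumes "infinite (UNIV :: 'k::field set)"
    and "tree_graph d E"
    and "\<forall>i<d. 1 \<le> n i"
    and "\<forall>e\<in>E. 1 \<le> r e"
  shows "(admissible d n E r \<longrightarrow>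
            (TNo d n E r :: ((nat \<Rightarrow> nat) \<Rightarrow> 'k) set) \<noteq> {}
          \<and> zariski_openin (idx d n) (TN d n E r) (TNo d n E r :: ((nat \<Rightarrow> nat) \<Rightarrow> 'k) set)
          \<and> zariski_dense_in (idx d n) (TN d n E r) (TNo d n E r :: ((nat \<Rightarrow> nat) \<Rightarrow> 'k) set))
       \<and> (\<not> admissible d n E r \<longrightarrow> (TNo d n E r :: ((nat \<Rightarrow> nat) \<Rightarrow> 'k) set) = {})"
proof (intro conjI impI)
  interpret tree d E using assms(2) by unfold_locales
  {
    assume "\<not> admissible d n E r"
    then show "(TNo d n E r :: ((nat \<Rightarrow> nat) \<Rightarrow> 'k) set) = {}"
      using assms(3,4) by (intro TNo_empty)
  }
  assume adm: "admissible d n E r"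
  have "(TNo d n E r :: ((nat \<Rightarrow> nat) \<Rightarrow> 'k) set) \<noteq> {}
      \<and> zariski_openin (idx d n) (TN d n E r) (TNo d n E r :: ((nat \<Rightarrow> nat) \<Rightarrow> 'k) set)
      \<and> zariski_dense_in (idx d n) (TN d n E r) (TNo d n E r :: ((nat \<Rightarrow> nat) \<Rightarrow> 'k) set)"
  \<comment> \<open>If all bonds are 1, which includes the case of no edges, there are no smaller
    bond dimensions and \<open>TNo\<close> is all of \<open>TN\<close>.\<close>
  proof (cases "\<exists>e0\<in>E. 2 \<le> r e0")
    case True
    then obtain e0 where e0: "e0 \<in> E" "2 \<le> r e0" by blast
    let ?U = "{v \<in> TN d n E r. \<forall>e\<in>E. full_edge_rank n e (r e) (v :: (nat \<Rightarrow> nat) \<Rightarrow> 'k)}"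
    have "TNo d n E r = ?U"
      using TNo_iff_full_edge_rank[OF assms(4) e0] TNo_def by blast
    moreover have "?U \<noteq> {}"
      using full_rank_tensor_exists[OF assms(1,4,3) adm] by (auto simp: TN_def)
    ultimately show ?thesis using full_edge_rank_open_dense[OF assms(1)] by simp
  next
    case False
    then have "{s. (\<forall>e\<in>E. 1 \<le> s e \<and> s e \<le> r e) \<and> (\<exists>e\<in>E. s e \<noteq> r e)} = {}"
      by fastforce
    then have TNo: "TNo d n E r = (TN d n E r :: ((nat \<Rightarrow> nat) \<Rightarrow> 'k) set)"
      unfolding TNo_def by (simp only: UN_empty Diff_empty)
    have "zariski_openin (idx d n) (TN d n E r) (TN d n E r :: ((nat \<Rightarrow> nat) \<Rightarrow> 'k) set)"
      unfolding zariski_openin_def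
      \<comment> \<open>The constant polynomial 1 has empty zero set, so \<open>TN\<close> is open
        in itself.\<close>
      by (intro conjI exI[of _ "{\<lambda>_. 1}"]) (auto simp: zero_set_def intro: polyfun.const)
    then show ?thesis
      unfolding TNo by (auto simp: TN_def zariski_dense_in_def)
  qed
  then show "(TNo d n E r :: ((nat \<Rightarrow> nat) \<Rightarrow> 'k) set) \<noteq> {}"
    and "zariski_openin (idx d n) (TN d n E r) (TNo d n E r :: ((nat \<Rightarrow> nat) \<Rightarrow> 'k) set)"
    and "zariski_dense_in (idx d n) (TN d n E r) (TNo d n E r :: ((nat \<Rightarrow> nat) \<Rightarrow> 'k) set)"
    by blast+
qed

end
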